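(* The Lagrangian Grassmannian $\mathrm{Lag}_k(n,2n)$ (the set of $n$-dimensional maximal isotropic subspaces of $k^{E}$ with respect to the standard symplectic form) is parameterized as a subset of the projective space of dimension $2^{n-2}\left(4+\binom{n}{2}\right)-1$ via $W\mapsto \Phi(W)=(\det(\Lambda[n,B]))_{B}$, where $B$ ranges over transversals and almost-transversals, and $\Lambda$ is any $n\times E$ matrix whose row space is $W$. The image is set-theoretically cut out by the following quadrics (the restricted Grassmann--Plücker relations): \[ \sum_{e\in S\setminus T} (-1)^{|\{s\in S: s<e\}| + |\{t\in T: t<e\}|}\, x_{S\setminus\{e\}}\, x_{T\cup\{e\}} = 0, \] where $S$ and $T$ are subsets of $E$ of sizes $n+1$ and $n-1$, respectively, $S$ contains exactly one skew pair $\{i,i^*\}$ for some $i\in[n]$, and $T$ contains no skew pair $\{j,j^*\}$.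
   Context: Let $k$ be a field and $E=\{1,\dots,n\}\cup\{1^*,\dots,n^*\}$ with the linear ordering $1<\cdots<n<1^*<\cdots<n^*$ and the involution $i\leftrightarrow i^*$. The standard symplectic form on $k^E$ is $\omega(X,Y)=\sum_{i=1}^n (X(i)Y(i^* )-X(i^* )Y(i))$. A skew pair is a set $\{i,i^*\}$. A transversal is an $n$-element subset of $E$ containing no skew pair; an almost-transversal is an $n$-element subset of $E$ containing exactly one skew pair; there are $2^n$ transversals and $n(n-1)2^{n-2}$ almost-transversals. The coordinates $x_B$ of the projective space are indexed by transversals and almost-transversals, subject to the identification $(-1)^{i} x_{U\cup\{i,i^*\}} = (-1)^{j} x_{U\cup\{j,j^*\}}$ for each subset $U$ of size $n-2$ containing no skew pair and distinct $i,j\in[n]$ with $\{i,i^*\}\cap U=\{j,j^*\}\cap U=\emptyset$. *)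

theory Defs
  imports "HOL-Library.Function_Algebras" "Jordan_Normal_Form.Determinant"
begin

text \<open>
  The ground set \<open>E = {1 < \<dots> < n < 1* < \<dots> < n*}\<close> is encoded order-isomorphically as
  \<open>{1..2 * n}\<close>, with \<open>i* = n + i\<close> for \<open>i \<in> {1..n}\<close>.
\<close>

definition ground :: "nat \<Rightarrow> nat set" where
  "ground n = {1..2 * n}"

definition star :: "nat \<Rightarrow> nat \<Rightarrow> nat" where
  "star n e = (if e \<le> n then n + e else e - n)"

definition skew_pairs :: "nat \<Rightarrow> nat set set" where
  "skew_pairs n = {{i, star n i} | i. i \<in> {1..n}}"

definition no_skew_pair :: "nat \<Rightarrow> nat set \<Rightarrow> bool" where
  "no_skew_pair n B \<longleftrightarrow> (\<nexists>P. P \<in> skew_pairs n \<and> P \<subseteq> B)"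

definition one_skew_pair :: "nat \<Rightarrow> nat set \<Rightarrow> bool" where
  "one_skew_pair n B \<longleftrightarrow> (\<exists>!P. P \<in> skew_pairs n \<and> P \<subseteq> B)"

definition transversals :: "nat \<Rightarrow> nat set set" where
  "transversals n = {B. B \<subseteq> ground n \<and> card B = n \<and> no_skew_pair n B}"

definition almost_transversals :: "nat \<Rightarrow> nat set set" where
  "almost_transversals n = {B. B \<subseteq> ground n \<and> card B = n \<and> one_skew_pair n B}"

text \<open>
  For a finite set \<open>I\<close>, the space \<open>k\<^sup>I\<close> is the subspace of functions vanishing outside
  \<open>I\<close> of the vector space of all functions into \<open>k\<close>. The latter is in general infinite
  dimensional, but all subspaces below are finite dimensional, so that \<open>dim\<close> has its usual
  meaning.
\<close>

definition fun_scale :: "'k::field \<Rightarrow> ('a \<Rightarrow> 'k) \<Rightarrow> 'a \<Rightarrow> 'k" where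
  "fun_scale c f = (\<lambda>x. c * f x)"

interpretation fun_space: vector_space "fun_scale :: 'k::field \<Rightarrow> ('a \<Rightarrow> 'k) \<Rightarrow> 'a \<Rightarrow> 'k"
  by unfold_locales (auto simp: fun_scale_def algebra_simps)

definition supported_on :: "'a set \<Rightarrow> ('a \<Rightarrow> 'k::field) set" where
  "supported_on I = {f. \<forall>x. x \<notin> I \<longrightarrow> f x = 0}"

definition symp_form :: "nat \<Rightarrow> (nat \<Rightarrow> 'k::field) \<Rightarrow> (nat \<Rightarrow> 'k) \<Rightarrow> 'k" where
  "symp_form n X Y = (\<Sum>i=1..n. X i * Y (star n i) - X (star n i) * Y i)"

definition isotropic_subspace :: "nat \<Rightarrow> (nat \<Rightarrow> 'k::field) set \<Rightarrow> bool" where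
  "isotropic_subspace n W \<longleftrightarrow>
     fun_space.subspace W \<and> W \<subseteq> supported_on (ground n) \<and> (\<forall>X\<in>W. \<forall>Y\<in>W. symp_form n X Y = 0)"

definition Lag :: "nat \<Rightarrow> (nat \<Rightarrow> 'k::field) set set" where
  "Lag n = {W. isotropic_subspace n W \<and> fun_space.dim W = n \<and>
               (\<forall>W'. isotropic_subspace n W' \<and> W \<subseteq> W' \<longrightarrow> W' = W)}"

text \<open>
  An \<open>n \<times> E\<close> matrix \<open>\<Lambda>\<close> is given by its rows \<open>\<Lambda> 1, \<dots>, \<Lambda> n \<in> k\<^sup>E\<close>;
  \<open>\<Lambda> r\<close> is irrelevant for other \<open>r\<close>.
\<close>

definition matrices :: "nat \<Rightarrow> (nat \<Rightarrow> nat \<Rightarrow> 'k::field) set" where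
  "matrices n = {\<Lambda>. \<forall>r\<in>{1..n}. \<Lambda> r \<in> supported_on (ground n)}"

definition row_space :: "nat \<Rightarrow> (nat \<Rightarrow> nat \<Rightarrow> 'k::field) \<Rightarrow> (nat \<Rightarrow> 'k) set" where
  "row_space n \<Lambda> = fun_space.span (\<Lambda> ` {1..n})"

text \<open>
  The columns of \<open>\<Lambda>[n,B]\<close> are taken in increasing order. Row and column indices of library
  matrices start from \<open>0\<close>.
\<close>

definition submatrix :: "nat \<Rightarrow> (nat \<Rightarrow> nat \<Rightarrow> 'k::field) \<Rightarrow> nat set \<Rightarrow> 'k mat" where
  "submatrix n \<Lambda> B = mat n n (\<lambda>(r, c). \<Lambda> (Suc r) (sorted_list_of_set B ! c))"

definition minors :: "nat \<Rightarrow> (nat \<Rightarrow> nat \<Rightarrow> 'k::field) \<Rightarrow> nat set \<Rightarrow> 'k" where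
  "minors n \<Lambda> B =
     (if B \<in> transversals n \<union> almost_transversals n then det (submatrix n \<Lambda> B) else 0)"

definition coord_space :: "nat \<Rightarrow> (nat set \<Rightarrow> 'k::field) set" where
  "coord_space n = {x \<in> supported_on (transversals n \<union> almost_transversals n).
     \<forall>U i j. U \<subseteq> ground n \<and> card U + 2 = n \<and> no_skew_pair n U \<and>
       i \<in> {1..n} \<and> j \<in> {1..n} \<and> i \<noteq> j \<and>
       {i, star n i} \<inter> U = {} \<and> {j, star n j} \<inter> U = {} \<longrightarrow>
       (-1) ^ i * x (U \<union> {i, star n i}) = (-1) ^ j * x (U \<union> {j, star n j})}"

text \<open>The projective space of \<open>V\<close> is the set of lines through the origin in \<open>V\<close>.\<close>

definition proj_point :: "('a \<Rightarrow> 'k::field) \<Rightarrow> ('a \<Rightarrow> 'k) set" where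
  "proj_point x = fun_space.span {x}"

definition proj_space :: "('a \<Rightarrow> 'k::field) set \<Rightarrow> ('a \<Rightarrow> 'k) set set" where
  "proj_space V = proj_point ` (V - {0})"

definition proj_dim :: "('a \<Rightarrow> 'k::field) set \<Rightarrow> int" where
  "proj_dim V = int (fun_space.dim V) - 1"

definition Phi :: "nat \<Rightarrow> (nat \<Rightarrow> 'k::field) set \<Rightarrow> (nat set \<Rightarrow> 'k) set" where
  "Phi n W = (THE p. \<exists>\<Lambda>\<in>matrices n. row_space n \<Lambda> = W \<and> p = proj_point (minors n \<Lambda>))"

definition restricted_GP :: "nat \<Rightarrow> (nat set \<Rightarrow> 'k::field) \<Rightarrow> bool" where
  "restricted_GP n x \<longleftrightarrow>
     (\<forall>S T. S \<subseteq> ground n \<and> T \<subseteq> ground n \<and> card S = n + 1 \<and> card T + 1 = n \<and>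
        one_skew_pair n S \<and> no_skew_pair n T \<longrightarrow>
        (\<Sum>e\<in>S - T. (-1) ^ (card {s \<in> S. s < e} + card {t \<in> T. t < e}) *
           x (S - {e}) * x (T \<union> {e})) = 0)"

end

theory Submission
  imports Defs
begin

text \<open>
  For \<open>T\<close> of size \<open>n - 1\<close> without skew pair, the coordinates \<open>x (T \<union> {e})\<close> with suitable
  signs form a vector \<open>circ x T\<close>. If \<open>x\<close> comes from a space \<open>W\<close>, then \<open>circ x T \<in> W\<close>, and
  the quadrics say that \<open>circ x T\<close> is orthogonal to the vector of minors of an
  \<open>(n + 1)\<close>-set \<open>S\<close>. The symplectic form of two vectors \<open>circ x (U \<union> {a})\<close>,
  \<open>circ x (U \<union> {c})\<close> is a multiple of the linear relation belonging to \<open>U\<close>, so isotropy and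
  the linear relations imply each other.

  Conversely, a nonzero solution \<open>x\<close> of the quadrics has a nonzero coordinate at some
  transversal \<open>B\<close>. The vectors \<open>circ x (B - {b})\<close>, \<open>b \<in> B\<close>, then span a Lagrangian subspace.
  Its minors solve the same quadrics and are proportional to \<open>x\<close> near \<open>B\<close>, and the quadrics
  with \<open>S = B \<union> {e}\<close> determine all other coordinates from those near \<open>B\<close>.
\<close>

section \<open>Minors and the row space\<close>

text \<open>A relation may mention only the available coordinates, so the argument for the ordinary
  Grassmannian has to be rerun with fewer minors. It survives because a Lagrangian space always has
  a transversal \<open>B\<close> on which its vectors are determined, and near a transversal every
  set that occurs is admissible: \<open>B - {b}\<close> as \<open>T\<close>, and \<open>B\<close>
  with one further element as \<open>S\<close>.

  The identity linking isotropy and the linear relations carries the factor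
  \<open>x (U \<union> {a, c})\<close>. From the linear relations to isotropy this is harmless, but
  in the other direction the factor may vanish and has to be dealt with separately.

  No change of basis is ever computed. That a solution is determined by its coordinates near
  \<open>B\<close> yields both the independence of \<open>Phi\<close> from the matrix and the fact
  that the space built from a solution \<open>x\<close> has the coordinates \<open>x\<close> up to a
  scalar. The linear relations enter the latter direction twice: for the nonzero transversal
  coordinate and for isotropy.\<close>

abbreviation rank_in :: "nat set \<Rightarrow> nat \<Rightarrow> nat" where
  "rank_in S e \<equiv> card {s \<in> S. s < e}"

lemma rank_in_less_card: "finite S \<Longrightarrow> v \<in> S \<Longrightarrow> rank_in S v < card S"
  by (rule psubset_card_mono) auto

lemma rank_in_nth:
  assumes "finite S" "i < card S"
  shows "rank_in S (sorted_list_of_set S ! i) = i"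
proof -
  let ?xs = "sorted_list_of_set S"
  have st: "sorted_wrt (<) ?xs"
    by simp
  have d: "distinct ?xs" and se: "set ?xs = S" and l: "length ?xs = card S"
    using assms by simp_all
  have "{s \<in> S. s < ?xs ! i} = (!) ?xs ` {..<i}"
  proof safe
    fix s assume "s \<in> S" "s < ?xs ! i"
    then obtain j where j: "j < length ?xs" "s = ?xs ! j" by (metis in_set_conv_nth se)
    have "j < i"
    proof (rule ccontr)
      assume "\<not> j < i"
      then have "?xs ! i \<le> ?xs ! j" using j(1) st by (intro sorted_nth_mono) auto
      with \<open>s < ?xs ! i\<close> j show False by simp
    qed
    then show "s \<in> (!) ?xs ` {..<i}" using j by auto
  next
    fix j assume "j < i"
    then show "?xs ! j \<in> S" using \<open>j < i\<close> assms(2) l se nth_mem[of j ?xs] by simp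
    show "?xs ! j < ?xs ! i" using sorted_wrt_nth_less[OF st \<open>j < i\<close>] assms(2) l by simp
  qed
  moreover have "inj_on ((!) ?xs) {..<i}"
    using assms(2) l d by (auto simp: inj_on_def nth_eq_iff_index_eq)
  ultimately show ?thesis by (simp add: card_image)
qed

lemma nth_rank_in:
  assumes "finite S" "v \<in> S"
  shows "sorted_list_of_set S ! rank_in S v = v"
proof -
  obtain i where "i < card S" "v = sorted_list_of_set S ! i"
    using assms in_set_conv_nth[of v "sorted_list_of_set S"] by auto
  then show ?thesis using rank_in_nth[OF assms(1)] by metis
qed

lemma bij_betw_nth_sorted_list_of_set:
  "finite S \<Longrightarrow> bij_betw ((!) (sorted_list_of_set S)) {..<card S} S"
  by (rule bij_betw_nth) auto

text \<open>The index shift is the one in \<open>mat_delete\<close>; thereby cofactors of a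
  submatrix become minors with columns in increasing order.\<close>

lemma nth_sorted_list_of_set_remove:
  assumes S: "finite S" and e: "e \<in> S" and c: "Suc c < card S"
  shows "sorted_list_of_set (S - {e}) ! c =
    sorted_list_of_set S ! (if c < rank_in S e then c else Suc c)"
proof -
  define c' where "c' = (if c < rank_in S e then c else Suc c)"
  define v where "v = sorted_list_of_set S ! c'"
  have c': "c' < card S" using c by (simp add: c'_def)
  have vS: "v \<in> S" using c' S nth_mem[of c' "sorted_list_of_set S"] by (simp add: v_def)
  have r: "rank_in S v = c'" using rank_in_nth[OF S c'] by (simp add: v_def)
  have ne: "v \<noteq> e"
  proof
    assume "v = e"
    with r have "c' = rank_in S e" by simp
    then show False by (simp add: c'_def split: if_splits)
  qed
  have le: "c' < rank_in S e" if "v < e"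
    unfolding r[symmetric] using vS S that by (intro psubset_card_mono) auto
  have ge: "rank_in S e \<le> c'" if "\<not> v < e"
    unfolding r[symmetric] using S that by (intro card_mono) auto
  have "rank_in (S - {e}) v = c"
  proof (cases "v < e")
    case True
    then have "{s \<in> S - {e}. s < v} = {s \<in> S. s < v}" by auto
    then have "rank_in (S - {e}) v = c'" using r by simp
    then show ?thesis using le[OF True] by (simp add: c'_def split: if_splits)
  next
    case False
    then have "{s \<in> S - {e}. s < v} = {s \<in> S. s < v} - {e}" and "e < v" using ne by auto
    then have "rank_in (S - {e}) v = c' - 1" using r e S by (simp add: card_Diff_singleton)
    then show ?thesis using ge[OF False] by (simp add: c'_def split: if_splits)
  qed
  then have "sorted_list_of_set (S - {e}) ! c = v"
    using nth_rank_in[of "S - {e}" v] S vS ne by simp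
  then show ?thesis by (simp add: v_def c'_def)
qed

text \<open>
  If \<open>x\<close> consists of the Pluecker coordinates of a space \<open>W\<close> and \<open>T\<close> has one element less than
  a basis, then \<open>circ x T\<close> is a vector of \<open>W\<close> vanishing on \<open>T\<close>.
\<close>

definition circ :: "(nat set \<Rightarrow> 'k::field) \<Rightarrow> nat set \<Rightarrow> nat \<Rightarrow> 'k" where
  "circ x T e = (if e \<in> T then 0 else (-1) ^ rank_in T e * x (insert e T))"

abbreviation full_minors :: "nat \<Rightarrow> (nat \<Rightarrow> nat \<Rightarrow> 'k::field) \<Rightarrow> nat set \<Rightarrow> 'k" where
  "full_minors n \<Lambda> B \<equiv> det (submatrix n \<Lambda> B)"

lemma fun_scale_apply: "fun_scale c f x = c * f x" by (simp add: fun_scale_def)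

lemma sum_fun_apply: "(\<Sum>i\<in>I. f i) x = (\<Sum>i\<in>I. f i x :: 'k::field)"
  by (induct I rule: infinite_finite_induct) auto

text \<open>Cramer's rule: expanding a minor along the column of \<open>e\<close> gives a
  combination of the entries \<open>\<Lambda> (Suc i) e\<close> whose cofactors \<open>N i\<close>
  involve only the columns in \<open>T\<close>. As they do not depend on \<open>e\<close>, they are
  the coefficients of a single combination of the rows. The sign in \<open>circ\<close> undoes the
  position of the column of \<open>e\<close>.\<close>

lemma circ_full_minors_in_row_space:
  fixes \<Lambda> :: "nat \<Rightarrow> nat \<Rightarrow> 'k::field"
  assumes T: "finite T" "card T + 1 = n"
  shows "circ (full_minors n \<Lambda>) T \<in> row_space n \<Lambda>"
proof -
  define N where "N i = det (mat (n-1) (n-1) (\<lambda>(r, c). \<Lambda> (Suc (if r < i then r else Suc r)) (sorted_list_of_set T ! c)))" for i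
  have "circ (full_minors n \<Lambda>) T = (\<Sum>i<n. fun_scale ((-1)^i * N i) (\<Lambda> (Suc i)))"
  proof
    fix e
    have rhs: "(\<Sum>i<n. fun_scale ((-1)^i * N i) (\<Lambda> (Suc i))) e = (\<Sum>i<n. (-1)^i * N i * \<Lambda> (Suc i) e)"
      by (simp add: sum_fun_apply fun_scale_apply)
    show "circ (full_minors n \<Lambda>) T e = (\<Sum>i<n. fun_scale ((-1)^i * N i) (\<Lambda> (Suc i))) e"
    proof (cases "e \<in> T")
      case True
      \<comment> \<open>The column of \<open>e\<close> occurs twice, in front and at its place in
        \<open>T\<close>, so the expansion along the front column vanishes, as does
        \<open>circ\<close> on \<open>T\<close>.\<close>
      define M where "M = mat n n (\<lambda>(r, c). \<Lambda> (Suc r) (case c of 0 \<Rightarrow> e | Suc c \<Rightarrow> sorted_list_of_set T ! c))"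
      have M: "M \<in> carrier_mat n n" by (simp add: M_def)
      have p: "rank_in T e < card T" "sorted_list_of_set T ! rank_in T e = e"
        using rank_in_less_card nth_rank_in True T by auto
      have "col M 0 = col M (Suc (rank_in T e))"
        using p T by (intro eq_vecI) (auto simp: M_def)
      then have "det M = 0"
        using p T by (intro det_identical_columns[OF M, of 0 "Suc (rank_in T e)"]) auto
      moreover have "det M = (\<Sum>i<n. M $$ (i, 0) * cofactor M i 0)"
        using T by (intro laplace_expansion_column[OF M]) auto
      moreover have "\<dots> = (\<Sum>i<n. (-1)^i * N i * \<Lambda> (Suc i) e)"
      proof (rule sum.cong[OF refl])
        fix i assume i: "i \<in> {..<n}"
        have "mat_delete M i 0 = mat (n-1) (n-1) (\<lambda>(r, c). \<Lambda> (Suc (if r < i then r else Suc r)) (sorted_list_of_set T ! c))"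
          using i by (intro eq_matI) (auto simp: mat_delete_def M_def)
        then show "M $$ (i, 0) * cofactor M i 0 = (-1)^i * N i * \<Lambda> (Suc i) e"
          using i by (simp add: cofactor_def N_def M_def)
      qed
      ultimately show ?thesis using True rhs by (simp add: circ_def)
    next
      case False
      let ?B = "insert e T" and ?p = "rank_in T e"
      define M where "M = submatrix n \<Lambda> ?B"
      have M: "M \<in> carrier_mat n n" by (simp add: M_def submatrix_def)
      have B: "finite ?B" "card ?B = n" "?B - {e} = T" using False T by auto
      have pe: "rank_in ?B e = ?p" by (rule arg_cong[of _ _ card]) auto
      have p: "?p < n" "sorted_list_of_set ?B ! ?p = e"
        using rank_in_less_card[of ?B e] nth_rank_in[of ?B e] B pe by auto
      have "det M = (\<Sum>i<n. M $$ (i, ?p) * cofactor M i ?p)"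
        by (intro laplace_expansion_column[OF M] p)
      also have "\<dots> = (\<Sum>i<n. (-1)^?p * ((-1)^i * N i * \<Lambda> (Suc i) e))"
      proof (rule sum.cong[OF refl])
        fix i assume i: "i \<in> {..<n}"
        have "mat_delete M i ?p = mat (n-1) (n-1) (\<lambda>(r, c). \<Lambda> (Suc (if r < i then r else Suc r)) (sorted_list_of_set T ! c))"
          using i nth_sorted_list_of_set_remove[of ?B e, unfolded B(2,3) pe] B
          by (intro eq_matI) (auto simp: mat_delete_def M_def submatrix_def)
        then show "M $$ (i, ?p) * cofactor M i ?p = (-1)^?p * ((-1)^i * N i * \<Lambda> (Suc i) e)"
          using i p by (simp add: cofactor_def N_def M_def submatrix_def power_add)
      qed
      also have "\<dots> = (-1)^?p * (\<Sum>i<n. (-1)^i * N i * \<Lambda> (Suc i) e)"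
        by (simp add: sum_distrib_left)
      finally have "(-1)^?p * det M = (\<Sum>i<n. (-1)^i * N i * \<Lambda> (Suc i) e)"
        by (simp flip: mult.assoc power_add power_mult_distrib)
      then show ?thesis using False rhs by (simp add: circ_def M_def)
    qed
  qed
  also have "\<dots> \<in> row_space n \<Lambda>"
    unfolding row_space_def by (intro fun_space.span_sum fun_space.span_scale fun_space.span_base) auto
  finally show ?thesis .
qed

text \<open>For a row of \<open>\<Lambda>\<close>, the square matrix on the columns \<open>S\<close>
  with this row repeated on top is singular, and the sum is its expansion along the top row.
  Linearity in \<open>w\<close> extends this to the row space.\<close>

lemma row_space_orthogonal_minors:
  fixes \<Lambda> :: "nat \<Rightarrow> nat \<Rightarrow> 'k::field"
  assumes S: "finite S" "card S = n + 1" and w: "w \<in> row_space n \<Lambda>"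
  shows "(\<Sum>e\<in>S. (-1) ^ rank_in S e * w e * full_minors n \<Lambda> (S - {e})) = 0"
  using w unfolding row_space_def
proof (induction rule: fun_space.span_induct_alt)
  case base
  then show ?case by simp
next
  case (step c v y)
  let ?xs = "sorted_list_of_set S"
  from step(1) obtain r where "v = \<Lambda> r" "r \<in> {1..n}" by blast
  then obtain k where k: "k < n" "v = \<Lambda> (Suc k)" by (cases r) (auto simp: less_eq_Suc_le)
  define M where "M = mat (Suc n) (Suc n) (\<lambda>(r, c). (case r of 0 \<Rightarrow> v | Suc r \<Rightarrow> \<Lambda> (Suc r)) (?xs ! c))"
  have M: "M \<in> carrier_mat (Suc n) (Suc n)" by (simp add: M_def)
  have "row M 0 = row M (Suc k)" using k by (intro eq_vecI) (auto simp: M_def)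
  then have "0 = det M" using k by (intro det_identical_rows[OF M, of 0 "Suc k", symmetric]) auto
  also have "det M = (\<Sum>j<Suc n. M $$ (0, j) * cofactor M 0 j)"
    by (intro laplace_expansion_row[OF M]) auto
  also have "\<dots> = (\<Sum>j<Suc n. (-1) ^ rank_in S (?xs ! j) * v (?xs ! j) * full_minors n \<Lambda> (S - {?xs ! j}))"
  proof (rule sum.cong[OF refl])
    fix j assume "j \<in> {..<Suc n}"
    then have j: "j < card S" using S by simp
    have r: "rank_in S (?xs ! j) = j" using rank_in_nth[OF S(1) j] .
    have "?xs ! j \<in> S" using j S nth_mem[of j ?xs] by simp
    then have "mat_delete M 0 j = submatrix n \<Lambda> (S - {?xs ! j})"
      using nth_sorted_list_of_set_remove[OF S(1), of "?xs ! j", unfolded r] S j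
      by (intro eq_matI) (auto simp: mat_delete_def M_def submatrix_def)
    then show "M $$ (0, j) * cofactor M 0 j = (-1) ^ rank_in S (?xs ! j) * v (?xs ! j) * full_minors n \<Lambda> (S - {?xs ! j})"
      using r j S by (simp add: M_def cofactor_def)
  qed
  also have "\<dots> = (\<Sum>e\<in>S. (-1) ^ rank_in S e * v e * full_minors n \<Lambda> (S - {e}))"
    using sum.reindex_bij_betw[OF bij_betw_nth_sorted_list_of_set[OF S(1)],
        of "\<lambda>e. (-1) ^ rank_in S e * v e * full_minors n \<Lambda> (S - {e})"] S by simp
  finally have v: "(\<Sum>e\<in>S. (-1) ^ rank_in S e * v e * full_minors n \<Lambda> (S - {e})) = 0" by simp
  have "(\<Sum>e\<in>S. (-1) ^ rank_in S e * (fun_scale c v + y) e * full_minors n \<Lambda> (S - {e})) =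
    c * (\<Sum>e\<in>S. (-1) ^ rank_in S e * v e * full_minors n \<Lambda> (S - {e})) +
    (\<Sum>e\<in>S. (-1) ^ rank_in S e * y e * full_minors n \<Lambda> (S - {e}))"
    unfolding sum_distrib_left sum.distrib[symmetric]
    by (intro sum.cong refl) (simp add: fun_scale_apply algebra_simps)
  then show ?case using v step.IH by simp
qed

section \<open>Skew pairs and transversals\<close>

definition index_of :: "nat \<Rightarrow> nat \<Rightarrow> nat" where
  "index_of n e = (if e \<le> n then e else e - n)"

lemma ground_cases:
  assumes "e \<in> ground n"
  obtains i where "i \<in> {1..n}" "e = i" | i where "i \<in> {1..n}" "e = n + i"
proof (cases "e \<le> n")
  case True
  then show ?thesis using assms that(1) by (auto simp: ground_def)
next
  case False
  then have "e - n \<in> {1..n}" "e = n + (e - n)" using assms by (auto simp: ground_def)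
  then show ?thesis by (rule that(2))
qed

lemma finite_ground [simp]: "finite (ground n)"
  by (simp add: ground_def)

lemma
  assumes "e \<in> ground n"
  shows star_in_ground [simp]: "star n e \<in> ground n"
    and star_star [simp]: "star n (star n e) = e"
    and star_neq [simp]: "star n e \<noteq> e" "e \<noteq> star n e"
    and index_of_in [simp]: "index_of n e \<in> {1..n}"
    and index_of_star [simp]: "index_of n (star n e) = index_of n e"
    and pair_of_index_of: "{index_of n e, star n (index_of n e)} = {e, star n e}"
  using assms by (cases rule: ground_cases; auto simp: ground_def star_def index_of_def)+

lemma pair_in_skew_pairs: "e \<in> ground n \<Longrightarrow> {e, star n e} \<in> skew_pairs n"
  unfolding skew_pairs_def by (metis (mono_tags, lifting) index_of_in mem_Collect_eq pair_of_index_of)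

lemma index_in_ground [simp]: "i \<in> {1..n} \<Longrightarrow> i \<in> ground n"
  by (simp add: ground_def)

lemma index_of_index [simp]: "i \<in> {1..n} \<Longrightarrow> index_of n i = i"
  by (simp add: index_of_def)

lemma index_of_eq_iff:
  assumes "e \<in> ground n" "f \<in> ground n"
  shows "index_of n e = index_of n f \<longleftrightarrow> f = e \<or> f = star n e"
  using assms(1) by (cases rule: ground_cases; use assms(2) in \<open>cases rule: ground_cases\<close>)
    (auto simp: index_of_def star_def)

lemma no_skew_pair_iff:
  assumes "B \<subseteq> ground n"
  shows "no_skew_pair n B \<longleftrightarrow> (\<forall>e\<in>B. star n e \<notin> B)"
proof
  assume B: "no_skew_pair n B"
  show "\<forall>e\<in>B. star n e \<notin> B"
  proof (intro ballI notI)
    fix e assume e: "e \<in> B" "star n e \<in> B"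
    then have g: "e \<in> ground n" using assms by auto
    show False using pair_in_skew_pairs[OF g] B e unfolding no_skew_pair_def by auto
  qed
qed (auto simp: no_skew_pair_def skew_pairs_def)

lemma one_skew_pairI:
  assumes "S \<subseteq> ground n" "e \<in> S" "star n e \<in> S"
    and "\<And>f. f \<in> S \<Longrightarrow> star n f \<in> S \<Longrightarrow> f = e \<or> f = star n e"
  shows "one_skew_pair n S"
  unfolding one_skew_pair_def
proof (rule ex1I[of _ "{e, star n e}"])
  have g: "e \<in> ground n" using assms by auto
  show "{e, star n e} \<in> skew_pairs n \<and> {e, star n e} \<subseteq> S"
    using pair_in_skew_pairs[OF g] assms by simp
  fix P assume "P \<in> skew_pairs n \<and> P \<subseteq> S"
  then obtain i where i: "i \<in> {1..n}" "P = {i, star n i}" "i \<in> S" "star n i \<in> S"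
    by (auto simp: skew_pairs_def)
  then show "P = {e, star n e}" using assms(4)[of i] g by auto
qed

lemma one_skew_pairE:
  assumes "S \<subseteq> ground n" "one_skew_pair n S"
  obtains i where "i \<in> {1..n}" "i \<in> S" "star n i \<in> S"
    "\<And>f. f \<in> S \<Longrightarrow> star n f \<in> S \<Longrightarrow> f = i \<or> f = star n i"
proof -
  obtain P where P: "P \<in> skew_pairs n" "P \<subseteq> S" "\<And>Q. Q \<in> skew_pairs n \<Longrightarrow> Q \<subseteq> S \<Longrightarrow> Q = P"
    using assms(2) unfolding one_skew_pair_def by blast
  from P(1) obtain i where i: "i \<in> {1..n}" "P = {i, star n i}" by (auto simp: skew_pairs_def)
  have "f = i \<or> f = star n i" if f: "f \<in> S" "star n f \<in> S" for f
  proof -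
    have g: "f \<in> ground n" using f assms by auto
    have "{f, star n f} = {i, star n i}" using P(3)[OF pair_in_skew_pairs[OF g]] f i(2) by simp
    then have "f \<in> {i, star n i}" by (metis insertI1)
    then show ?thesis by simp
  qed
  moreover have "i \<in> S" "star n i \<in> S" using P(2) i(2) by simp_all
  ultimately show ?thesis using that[of i] i(1) by simp
qed

section \<open>Index sets of the coordinates\<close>

abbreviation coord_sets :: "nat \<Rightarrow> nat set set" where
  "coord_sets n \<equiv> transversals n \<union> almost_transversals n"

text \<open>Expresses "at most one skew pair" through elements, so that membership can be checked
  without distinguishing transversals from almost-transversals.\<close>

lemma coord_sets_iff:
  "A \<in> coord_sets n \<longleftrightarrow> A \<subseteq> ground n \<and> card A = n \<and>
    (\<forall>e\<in>A. \<forall>f\<in>A. star n e \<in> A \<longrightarrow> star n f \<in> A \<longrightarrow> f = e \<or> f = star n e)"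
proof (cases "A \<subseteq> ground n \<and> card A = n")
  case True
  show ?thesis
  proof
    assume "A \<in> coord_sets n"
    then consider "no_skew_pair n A" | "one_skew_pair n A"
      by (auto simp: transversals_def almost_transversals_def)
    then have "\<forall>e\<in>A. \<forall>f\<in>A. star n e \<in> A \<longrightarrow> star n f \<in> A \<longrightarrow> f = e \<or> f = star n e"
    proof cases
      case 1
      then show ?thesis using no_skew_pair_iff[of A n] True by auto
    next
      case 2
      show ?thesis
      proof (rule one_skew_pairE[OF _ 2])
        show "A \<subseteq> ground n" using True ..
        fix i assume i: "i \<in> {1..n}" "i \<in> A" "star n i \<in> A"
          and *: "\<And>f. f \<in> A \<Longrightarrow> star n f \<in> A \<Longrightarrow> f = i \<or> f = star n i"
        have g: "i \<in> ground n" using i by simp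
        show ?thesis
        proof (intro ballI impI)
          fix e f assume "e \<in> A" "f \<in> A" "star n e \<in> A" "star n f \<in> A"
          then show "f = e \<or> f = star n e" using *[of e] *[of f] g by auto
        qed
      qed
    qed
    with True show "A \<subseteq> ground n \<and> card A = n \<and>
      (\<forall>e\<in>A. \<forall>f\<in>A. star n e \<in> A \<longrightarrow> star n f \<in> A \<longrightarrow> f = e \<or> f = star n e)" by simp
  next
    assume R: "A \<subseteq> ground n \<and> card A = n \<and>
      (\<forall>e\<in>A. \<forall>f\<in>A. star n e \<in> A \<longrightarrow> star n f \<in> A \<longrightarrow> f = e \<or> f = star n e)"
    show "A \<in> coord_sets n"
    proof (cases "no_skew_pair n A")
      case False
      then obtain e where "e \<in> A" "star n e \<in> A" using no_skew_pair_iff[of A n] R by auto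
      then have "one_skew_pair n A" using R by (intro one_skew_pairI[of A n e]) auto
      then show ?thesis using R by (simp add: almost_transversals_def)
    qed (use R in \<open>simp add: transversals_def\<close>)
  qed
qed (auto simp: transversals_def almost_transversals_def)

lemma transversals_iff:
  "B \<in> transversals n \<longleftrightarrow> B \<subseteq> ground n \<and> card B = n \<and> (\<forall>e\<in>B. star n e \<notin> B)"
  using no_skew_pair_iff[of B n] by (auto simp: transversals_def)

lemma inj_on_index_of:
  assumes "U \<subseteq> ground n" "no_skew_pair n U"
  shows "inj_on (index_of n) U"
proof (rule inj_onI)
  fix e f assume "e \<in> U" "f \<in> U" "index_of n e = index_of n f"
  then show "e = f"
    using assms index_of_eq_iff[of e n f] no_skew_pair_iff[OF assms(1)] by auto
qed

text \<open>The \<open>n\<close> elements of \<open>B\<close> have distinct indices in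
  \<open>{1..n}\<close>, so every index occurs and exactly one element of each pair is
  taken.\<close>

lemma transversal_star_iff:
  assumes B: "B \<in> transversals n" and e: "e \<in> ground n"
  shows "star n e \<in> B \<longleftrightarrow> e \<notin> B"
proof -
  have B': "B \<subseteq> ground n" "card B = n" "no_skew_pair n B"
    using B by (auto simp: transversals_def)
  have "index_of n ` B = {1..n}"
  proof (rule card_subset_eq)
    show "index_of n ` B \<subseteq> {1..n}" using B' by (auto dest!: index_of_in[OF subsetD])
    show "card (index_of n ` B) = card {1..n}"
      using card_image[OF inj_on_index_of[OF B'(1,3)]] B' by simp
  qed simp
  then obtain b where b: "b \<in> B" "index_of n e = index_of n b" using index_of_in[OF e] by (metis imageE)
  then have "b = e \<or> b = star n e" using index_of_eq_iff[OF e, of b] B' by auto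
  then show ?thesis using b e B'(3) no_skew_pair_iff[OF B'(1)] by auto
qed

lemma insert_in_coord_sets:
  assumes T: "T \<subseteq> ground n" "card T + 1 = n" "no_skew_pair n T" and e: "e \<in> ground n" "e \<notin> T"
  shows "insert e T \<in> coord_sets n"
proof -
  have f: "finite T" using T finite_subset[OF _ finite_ground] by blast
  have *: "\<forall>e\<in>T. star n e \<notin> T" using T no_skew_pair_iff by blast
  have c: "g = e \<or> g = star n e" if "g \<in> insert e T" "star n g \<in> insert e T" for g
  proof -
    have "star n (star n g) = g" using that T e by (intro star_star) auto
    then show ?thesis using that * by auto
  qed
  have ss: "star n (star n e) = e" using e by simp
  have "f = g \<or> f = star n g" if "g \<in> insert e T" "star n g \<in> insert e T"
    "f \<in> insert e T" "star n f \<in> insert e T" for f g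
    using c[OF that(1,2)] c[OF that(3,4)] ss by metis
  then show ?thesis unfolding coord_sets_iff using T e f by simp
qed

lemma one_skew_pair_insert_transversal:
  assumes "B \<in> transversals n" "e \<in> ground n" "e \<notin> B"
  shows "one_skew_pair n (insert e B)"
proof (rule one_skew_pairI[of _ _ e])
  show "insert e B \<subseteq> ground n" using assms by (auto simp: transversals_def)
  show "star n e \<in> insert e B" using transversal_star_iff[OF assms(1,2)] assms(3) by simp
  fix f assume f: "f \<in> insert e B" "star n f \<in> insert e B"
  then have "f \<in> ground n" using \<open>insert e B \<subseteq> ground n\<close> by auto
  then have "star n (star n f) = f" "star n f \<in> B \<longleftrightarrow> f \<notin> B"
    using transversal_star_iff[OF assms(1)] by auto
  then show "f = e \<or> f = star n e" using f by auto
qed simp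

text \<open>Together with \<open>insert_in_coord_sets\<close> this shows that a restricted relation
  involves only available coordinates, so that full minors may be replaced by \<open>minors\<close>
  in it.\<close>

lemma one_skew_pair_remove:
  assumes S: "S \<subseteq> ground n" "card S = n + 1" "one_skew_pair n S" "e \<in> S"
  shows "S - {e} \<in> coord_sets n"
proof (rule one_skew_pairE[OF S(1,3)])
  fix i assume i: "i \<in> {1..n}" "i \<in> S" "star n i \<in> S"
    and *: "\<And>f. f \<in> S \<Longrightarrow> star n f \<in> S \<Longrightarrow> f = i \<or> f = star n i"
  have "card (S - {e}) = n" using S by (simp add: card_Diff_singleton)
  moreover have ss: "star n (star n i) = i" using i by simp
  have "f = g \<or> f = star n g" if "g \<in> S" "star n g \<in> S" "f \<in> S" "star n f \<in> S" for f g
    using *[OF that(1,2)] *[OF that(3,4)] ss by metis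
  ultimately show ?thesis unfolding coord_sets_iff using S by auto
qed

text \<open>Serves the induction towards \<open>B\<close>, where \<open>A - {e}\<close> has to be
  admissible as \<open>T\<close>. If \<open>A\<close> contains a pair, one of its two elements must
  go, and exactly one of them lies outside \<open>B\<close>.\<close>

lemma coord_set_exchange:
  assumes A: "A \<in> coord_sets n" and B: "B \<in> transversals n" and ne: "A \<noteq> B"
  obtains e where "e \<in> A" "e \<notin> B" "no_skew_pair n (A - {e})"
proof -
  have A': "A \<subseteq> ground n" "card A = n"
    "\<And>e f. e \<in> A \<Longrightarrow> f \<in> A \<Longrightarrow> star n e \<in> A \<Longrightarrow> star n f \<in> A \<Longrightarrow> f = e \<or> f = star n e"
    using A unfolding coord_sets_iff by auto
  show ?thesis
  proof (cases "no_skew_pair n A")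
    case True
    have "\<not> A \<subseteq> B"
    proof
      assume "A \<subseteq> B"
      moreover have "finite B" "card B = n" using B finite_subset[OF _ finite_ground] by (auto simp: transversals_def)
      ultimately show False using ne A' card_subset_eq by blast
    qed
    then obtain e where e: "e \<in> A" "e \<notin> B" by blast
    show ?thesis
    proof (rule that[OF e])
      show "no_skew_pair n (A - {e})" using True unfolding no_skew_pair_def by blast
    qed
  next
    case False
    then obtain f where f: "f \<in> A" "star n f \<in> A" using no_skew_pair_iff[OF A'(1)] by auto
    have g: "f \<in> ground n" using f A' by auto
    define e where "e = (if f \<in> B then star n f else f)"
    have e: "e \<in> A" "e \<notin> B" using f transversal_star_iff[OF B g] by (auto simp: e_def)
    show ?thesis
    proof (rule that[OF e])
      have "star n h \<notin> A - {e}" if h: "h \<in> A - {e}" for h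
      proof
        assume h': "star n h \<in> A - {e}"
        then have "h = f \<or> h = star n f" using h f A'(3) by blast
        then show False using h h' g by (auto simp: e_def split: if_splits)
      qed
      then show "no_skew_pair n (A - {e})" using no_skew_pair_iff[of "A - {e}" n] A' by auto
    qed
  qed
qed

text \<open>By counting, \<open>U\<close> meets every skew pair except those of \<open>i\<close> and \<open>j\<close>.\<close>

definition misses :: "nat \<Rightarrow> nat set \<Rightarrow> nat \<Rightarrow> nat \<Rightarrow> bool" where
  "misses n U i j \<longleftrightarrow> U \<subseteq> ground n \<and> card U + 2 = n \<and> no_skew_pair n U \<and>
     i \<in> {1..n} \<and> j \<in> {1..n} \<and> i \<noteq> j \<and> {i, star n i} \<inter> U = {} \<and> {j, star n j} \<inter> U = {}"

lemma misses_sym: "misses n U i j \<Longrightarrow> misses n U j i"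
  by (auto simp: misses_def)

lemma coord_space_iff:
  "x \<in> coord_space n \<longleftrightarrow> x \<in> supported_on (coord_sets n) \<and>
    (\<forall>U i j. misses n U i j \<longrightarrow>
      (-1) ^ i * x (U \<union> {i, star n i}) = (-1) ^ j * x (U \<union> {j, star n j}))"
  unfolding coord_space_def misses_def by blast

context
  fixes n U i j
  assumes m: "misses n U i j"
begin

lemma misses_finite: "finite U"
  using m finite_subset[OF _ finite_ground] by (auto simp: misses_def)

lemma misses_transversal:
  assumes a: "a \<in> {i, star n i}" and c: "c \<in> {j, star n j}"
  shows "U \<union> {a, c} \<in> transversals n"
proof -
  have ij: "i \<in> ground n" "j \<in> ground n" "i \<in> {1..n}" "j \<in> {1..n}" "i \<noteq> j" using m by (auto simp: misses_def)
  have ac: "a \<in> ground n" "c \<in> ground n" "index_of n a = i" "index_of n c = j"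
    using a c ij by auto
  then have ne: "a \<noteq> c" "star n a \<noteq> c" "star n c \<noteq> a" using ij by auto
  have U: "a \<notin> U" "c \<notin> U" "star n a \<notin> U" "star n c \<notin> U"
    using a c ij m by (auto simp: misses_def)
  have UU: "U \<subseteq> ground n" "\<forall>e\<in>U. star n e \<notin> U" "card U + 2 = n"
    using m no_skew_pair_iff by (auto simp: misses_def)
  have nst: "star n e \<noteq> a" "star n e \<noteq> c" if "e \<in> U" for e
    using star_star[of e n] UU U that by auto
  have "card (U \<union> {a, c}) = n" using misses_finite U ne UU by simp
  then show ?thesis unfolding transversals_iff using U UU ac ne nst by auto
qed

lemma misses_almost_transversal: "U \<union> {i, star n i} \<in> almost_transversals n"
proof -
  have ij: "i \<in> ground n" "i \<in> {1..n}" using m by (auto simp: misses_def)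
  have U: "i \<notin> U" "star n i \<notin> U" using m by (auto simp: misses_def)
  have UU: "U \<subseteq> ground n" "\<forall>e\<in>U. star n e \<notin> U" "card U + 2 = n"
    using m no_skew_pair_iff by (auto simp: misses_def)
  have nst: "star n e \<noteq> i" "star n e \<noteq> star n i" if "e \<in> U" for e
  proof -
    have e: "star n (star n e) = e" using that UU by (intro star_star) auto
    show "star n e \<noteq> i" using U(2) that e by metis
    show "star n e \<noteq> star n i" using U(1) that e star_star[OF ij(1)] by metis
  qed
  have "card (U \<union> {i, star n i}) = n" using misses_finite U UU ij star_neq[OF ij(1)] by simp
  moreover have "one_skew_pair n (U \<union> {i, star n i})"
    by (rule one_skew_pairI[of _ _ i]) (use ij UU nst in auto)
  ultimately show ?thesis using UU ij by (simp add: almost_transversals_def)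
qed

lemma misses_cover:
  assumes "k \<in> {1..n}" "k \<noteq> i" "k \<noteq> j"
  shows "k \<in> U \<longleftrightarrow> star n k \<notin> U"
proof -
  have ij: "i \<in> {1..n}" "j \<in> {1..n}" using m by (auto simp: misses_def)
  have "U \<union> {i, j} \<in> transversals n" using misses_transversal by simp
  from transversal_star_iff[OF this index_in_ground[OF assms(1)]]
  show ?thesis using assms ij by (auto simp: star_def)
qed

text \<open>The origin of the signs \<open>(-1) ^ i\<close>. Below \<open>star n i\<close> lie all
  unstarred elements of \<open>U\<close> and the starred ones in \<open>?R\<close>. By
  \<open>misses_cover\<close>, \<open>?L\<close> and \<open>?R\<close> together contain one element
  for each index below \<open>i\<close> other than \<open>j\<close>. The summand
  \<open>card (U \<inter> {1..n})\<close> is the same for \<open>i\<close> and \<open>j\<close> and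
  becomes a common sign.\<close>

lemma misses_rank:
  "rank_in U i + rank_in U (star n i) = card (U \<inter> {1..n}) + card ({1..<i} - {j})"
proof -
  have i: "i \<in> {1..n}" and j: "j \<in> {1..n}" using m by (auto simp: misses_def)
  have U: "U \<subseteq> ground n" "no_skew_pair n U" "i \<notin> U" "j \<notin> U" "n + j \<notin> U"
    using m by (auto simp: misses_def star_def)
  let ?L = "{u \<in> U. u < i}" and ?R = "{u \<in> U. n < u \<and> u < n + i}"
  have "{u \<in> U. u < star n i} = (U \<inter> {1..n}) \<union> ?R"
    using U(1) i by (auto simp: star_def ground_def)
  then have 1: "rank_in U (star n i) = card (U \<inter> {1..n}) + card ?R"
  proof (rule ssubst[where P = "\<lambda>X. card X = card (U \<inter> {1..n}) + card ?R"], intro card_Un_disjoint)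
    show "finite (U \<inter> {1..n})" "finite ?R" using misses_finite by simp_all
    show "(U \<inter> {1..n}) \<inter> ?R = {}" by auto
  qed
  have "card ?L + card ?R = card (?L \<union> ?R)"
    using misses_finite i by (intro card_Un_disjoint[symmetric]) auto
  also have "\<dots> = card (index_of n ` (?L \<union> ?R))"
    using inj_on_subset[OF inj_on_index_of[OF U(1,2)]] by (intro card_image[symmetric]) auto
  also have "index_of n ` (?L \<union> ?R) = {1..<i} - {j}"
  proof (intro equalityI subsetI)
    fix k assume "k \<in> index_of n ` (?L \<union> ?R)"
    then obtain u where "u \<in> U" "k = index_of n u" "u < i \<or> n < u \<and> u < n + i" by auto
    then show "k \<in> {1..<i} - {j}" using U i j by (auto simp: index_of_def ground_def)
  next
    fix k assume k: "k \<in> {1..<i} - {j}"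
    then have "k \<in> U \<or> n + k \<in> U" using misses_cover[of k] i by (auto simp: star_def)
    then show "k \<in> index_of n ` (?L \<union> ?R)"
    proof
      assume "k \<in> U"
      then show ?thesis using k i by (intro image_eqI[of _ _ k]) (auto simp: index_of_def)
    next
      assume "n + k \<in> U"
      then show ?thesis using k i by (intro image_eqI[of _ _ "n + k"]) (auto simp: index_of_def)
    qed
  qed
  finally show ?thesis using 1 by simp
qed

end

text \<open>The index \<open>j\<close> is found by counting: \<open>i\<close> and the indices of the
  \<open>n - 2\<close> elements of \<open>U\<close> cannot exhaust \<open>{1..n}\<close>.\<close>

lemma almost_transversalE:
  assumes "A \<in> almost_transversals n"
  obtains U i j where "misses n U i j" "A = U \<union> {i, star n i}"
proof -
  have A: "A \<subseteq> ground n" "card A = n" "one_skew_pair n A"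
    using assms by (auto simp: almost_transversals_def)
  have fA: "finite A" using A finite_subset[OF _ finite_ground] by blast
  show ?thesis
  proof (rule one_skew_pairE[OF A(1,3)])
    fix i assume i: "i \<in> {1..n}" "i \<in> A" "star n i \<in> A"
      and *: "\<And>f. f \<in> A \<Longrightarrow> star n f \<in> A \<Longrightarrow> f = i \<or> f = star n i"
    have ig: "i \<in> ground n" using i by simp
    let ?U = "A - {i, star n i}"
    have ss: "star n i \<noteq> i" using ig by simp
    have "card {i, star n i} \<le> card A" using i fA by (intro card_mono) auto
    moreover have "card ?U = card A - card {i, star n i}" using i fA by (intro card_Diff_subset) auto
    ultimately have cU: "card ?U + 2 = n" using A ss by simp
    have Ug: "?U \<subseteq> ground n" using A by auto
    have nU: "no_skew_pair n ?U" using no_skew_pair_iff[OF Ug] * by auto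
    have "card (index_of n ` ?U) < card ({1..n} - {i})"
      using card_image_le[of ?U "index_of n"] fA cU i by simp
    then have "\<not> {1..n} - {i} \<subseteq> index_of n ` ?U"
      using card_mono[of "index_of n ` ?U" "{1..n} - {i}"] fA by auto
    then obtain j where j: "j \<in> {1..n}" "j \<noteq> i" "j \<notin> index_of n ` ?U" by blast
    have "{j, star n j} \<inter> ?U = {}"
    proof (rule ccontr)
      assume "{j, star n j} \<inter> ?U \<noteq> {}"
      then obtain e where "e \<in> ?U" "e = j \<or> e = star n j" by blast
      moreover have "index_of n j = j" "index_of n (star n j) = j" using j by simp_all
      ultimately show False using j(3) by (metis imageI)
    qed
    then have "misses n ?U i j" using Ug cU nU i j by (auto simp: misses_def)
    moreover have "A = ?U \<union> {i, star n i}" using i by auto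
    ultimately show ?thesis by (rule that)
  qed
qed

section \<open>Linear and quadratic relations\<close>

lemma rank_in_insert:
  assumes "finite U" "a \<notin> U"
  shows "rank_in (insert a U) e = rank_in U e + of_bool (a < e)"
proof (cases "a < e")
  case True
  then have "{s \<in> insert a U. s < e} = insert a {s \<in> U. s < e}" by auto
  then show ?thesis using True assms by simp
next
  case False
  then have "{s \<in> insert a U. s < e} = {s \<in> U. s < e}" by auto
  then show ?thesis using False by simp
qed

definition symp_term :: "nat \<Rightarrow> (nat \<Rightarrow> 'k::field) \<Rightarrow> (nat \<Rightarrow> 'k) \<Rightarrow> nat \<Rightarrow> 'k" where
  "symp_term n X Y k = X k * Y (star n k) - X (star n k) * Y k"

lemma symp_form_eq_sum: "symp_form n X Y = sum (symp_term n X Y) {1..n}"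
  by (simp add: symp_form_def symp_term_def)

lemma symp_form_two:
  assumes "i \<in> {1..n}" "j \<in> {1..n}" "i \<noteq> j"
    and "\<And>k. k \<in> {1..n} \<Longrightarrow> k \<noteq> i \<Longrightarrow> k \<noteq> j \<Longrightarrow> symp_term n X Y k = 0"
  shows "symp_form n X Y = symp_term n X Y i + symp_term n X Y j"
proof -
  have "symp_form n X Y = sum (symp_term n X Y) {i, j}"
    unfolding symp_form_eq_sum using assms by (intro sum.mono_neutral_right) auto
  then show ?thesis using assms(3) by simp
qed

lemma symp_form_one:
  assumes "i \<in> {1..n}"
    and "\<And>k. k \<in> {1..n} \<Longrightarrow> k \<noteq> i \<Longrightarrow> symp_term n X Y k = 0"
  shows "symp_form n X Y = symp_term n X Y i"
proof -
  have "symp_form n X Y = sum (symp_term n X Y) {i}"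
    unfolding symp_form_eq_sum using assms by (intro sum.mono_neutral_right) auto
  then show ?thesis by simp
qed

lemma symp_term_index_of:
  assumes "a \<in> ground n"
  shows "symp_term n X Y (index_of n a) =
    (if a \<le> n then 1 else -1) * (X a * Y (star n a) - X (star n a) * Y a)"
  using assms by (cases rule: ground_cases) (auto simp: index_of_def symp_term_def star_def)

lemma less_star_iff: "a \<in> ground n \<Longrightarrow> a < star n a \<longleftrightarrow> a \<le> n"
  by (auto simp: star_def ground_def)

definition subtransversals :: "nat \<Rightarrow> nat set set" where
  "subtransversals n = {T. T \<subseteq> ground n \<and> card T + 1 = n \<and> no_skew_pair n T}"

lemma subtransversals_finite: "T \<in> subtransversals n \<Longrightarrow> finite T"
  using finite_subset[OF _ finite_ground] by (auto simp: subtransversals_def)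

lemma transversal_remove_in_subtransversals:
  assumes "B \<in> transversals n" "b \<in> B"
  shows "B - {b} \<in> subtransversals n"
proof -
  have B: "B \<subseteq> ground n" "card B = n" "no_skew_pair n B" using assms by (auto simp: transversals_def)
  have "finite B" using B finite_subset[OF _ finite_ground] by blast
  then have "card (B - {b}) + 1 = n" using assms(2) B card_Suc_Diff1[of B b] by simp
  moreover have "no_skew_pair n (B - {b})" using B(3) unfolding no_skew_pair_def by blast
  ultimately show ?thesis using B by (auto simp: subtransversals_def)
qed

lemma misses_subtransversal:
  assumes m: "misses n U i j" and a: "a \<in> {i, star n i}"
  shows "insert a U \<in> subtransversals n"
proof -
  have "U \<union> {a, j} \<in> transversals n" using misses_transversal[OF m a] by simp
  moreover have "j \<notin> insert a U"
    using m a by (auto simp: misses_def star_def split: if_splits)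
  then have "insert a U = (U \<union> {a, j}) - {j}" by auto
  ultimately show ?thesis using transversal_remove_in_subtransversals[of _ n j] by simp
qed

text \<open>Both vectors vanish on \<open>U\<close>, which meets every pair except those of
  \<open>i\<close> and \<open>j\<close>, so two summands of the form survive. Since the first vector
  vanishes at \<open>a\<close> and the second at \<open>c\<close>, each summand is a single product
  containing \<open>x (U \<union> {a, c})\<close>. The factor \<open>\<sigma>\<close> is a sign
  depending on the order of the elements; later only \<open>\<sigma> \<noteq> 0\<close>
  matters.\<close>

lemma misses_symp_form:
  fixes x :: "nat set \<Rightarrow> 'k::field"
  assumes m: "misses n U i j" and a: "a \<in> {i, star n i}" and c: "c \<in> {j, star n j}"
  obtains \<sigma> :: 'k where "\<sigma> \<noteq> 0"
    "symp_form n (circ x (insert a U)) (circ x (insert c U)) = \<sigma> * x (U \<union> {a, c}) *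
       ((-1) ^ i * x (U \<union> {i, star n i}) - (-1) ^ j * x (U \<union> {j, star n j}))"
proof -
  let ?X = "circ x (insert a U)" and ?Y = "circ x (insert c U)"
  have ij: "i \<in> {1..n}" "j \<in> {1..n}" "i \<noteq> j" using m by (auto simp: misses_def)
  then have ig: "i \<in> ground n" "j \<in> ground n" by simp_all
  have ac: "a \<in> ground n" "c \<in> ground n" "index_of n a = i" "index_of n c = j"
    using a c ij ig by auto
  have pa: "{a, star n a} = {i, star n i}" and pc: "{c, star n c} = {j, star n j}"
    using pair_of_index_of ac by metis+
  have U: "a \<notin> U" "c \<notin> U" "star n a \<notin> U" "star n c \<notin> U"
    using m pa pc unfolding misses_def by blast+
  have ne: "a \<noteq> c" "star n a \<noteq> a" "star n c \<noteq> c" "star n a \<noteq> c" "star n c \<noteq> a"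
    using ac ij index_of_star by auto
  have fU: "finite U" using misses_finite[OF m] .
  let ?Z = "x (U \<union> {a, c})" and ?xi = "x (U \<union> {i, star n i})" and ?xj = "x (U \<union> {j, star n j})"
  have sets: "insert (star n a) (insert a U) = U \<union> {i, star n i}"
    "insert (star n c) (insert c U) = U \<union> {j, star n j}"
    "insert c (insert a U) = U \<union> {a, c}" "insert a (insert c U) = U \<union> {a, c}"
    unfolding pa[symmetric] pc[symmetric] by auto
  have X: "?X a = 0" "?X (star n a) = (-1) ^ (rank_in U (star n a) + of_bool (a < star n a)) * ?xi"
    "?X c = (-1) ^ (rank_in U c + of_bool (a < c)) * ?Z"
    using U ne unfolding circ_def rank_in_insert[OF fU U(1)] sets by simp_all
  have Y: "?Y c = 0" "?Y (star n c) = (-1) ^ (rank_in U (star n c) + of_bool (c < star n c)) * ?xj"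
    "?Y a = (-1) ^ (rank_in U a + of_bool (c < a)) * ?Z"
    using U ne unfolding circ_def rank_in_insert[OF fU U(2)] sets by auto
  have "symp_form n ?X ?Y = symp_term n ?X ?Y i + symp_term n ?X ?Y j"
  proof (rule symp_form_two[OF ij])
    fix k assume "k \<in> {1..n}" "k \<noteq> i" "k \<noteq> j"
    then have "k \<in> U \<or> star n k \<in> U" using misses_cover[OF m] by blast
    then show "symp_term n ?X ?Y k = 0" by (auto simp: symp_term_def circ_def)
  qed
  also have "symp_term n ?X ?Y i = (if a \<le> n then 1 else -1) * (- ?X (star n a) * ?Y a)"
    using symp_term_index_of[OF ac(1), of ?X ?Y] ac X Y by simp
  \<comment> \<open>The factor from \<open>symp_term_index_of\<close>, the minus sign and the
    exponent \<open>of_bool (a < star n a)\<close> cancel, whether or not \<open>a\<close> is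
    starred.\<close>
  also have "\<dots> = (-1) ^ of_bool (c < a) * ((-1) ^ (rank_in U a + rank_in U (star n a)) * ?Z * ?xi)"
    unfolding X Y less_star_iff[OF ac(1)] by (simp add: power_add)
  also have "rank_in U a + rank_in U (star n a) = rank_in U i + rank_in U (star n i)"
    using a ig by auto
  also have "\<dots> = card (U \<inter> {1..n}) + card ({1..<i} - {j})" by (rule misses_rank[OF m])
  also have "symp_term n ?X ?Y j = (if c \<le> n then 1 else -1) * (?X c * ?Y (star n c))"
    using symp_term_index_of[OF ac(2), of ?X ?Y] ac X Y by simp
  also have "\<dots> = - ((-1) ^ of_bool (a < c) * ((-1) ^ (rank_in U c + rank_in U (star n c)) * ?Z * ?xj))"
    unfolding X Y less_star_iff[OF ac(2)] by (simp add: power_add)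
  also have "rank_in U c + rank_in U (star n c) = rank_in U j + rank_in U (star n j)"
    using c ig by auto
  also have "\<dots> = card (U \<inter> {1..n}) + card ({1..<j} - {i})" by (rule misses_rank[OF misses_sym[OF m]])
  finally have eq: "symp_form n ?X ?Y = (-1) ^ card (U \<inter> {1..n}) * ?Z *
    ((-1) ^ (of_bool (c < a) + card ({1..<i} - {j})) * ?xi - (-1) ^ (of_bool (a < c) + card ({1..<j} - {i})) * ?xj)"
    by (simp add: power_add algebra_simps)
  \<comment> \<open>\<open>card ({1..<i} - {j})\<close> is \<open>i - 1\<close>, lowered by one if
    \<open>j < i\<close>; \<open>t\<close> collects this correction and the order of
    \<open>a\<close> and \<open>c\<close>. The same \<open>t\<close> serves for \<open>j\<close>,
    because exchanging the roles flips both truth values.\<close>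
  define t :: 'k where "t = (-1) ^ (of_bool (c < a) + of_bool (j < i) + 1)"
  define p q where "p = card ({1..<i} - {j})" and "q = card ({1..<j} - {i})"
  have "i = p + of_bool (j < i) + 1" "j = q + of_bool (i < j) + 1"
    unfolding p_def q_def using ij by (auto simp: card_Diff_singleton_if)
  then have pw: "(-1 :: 'k) ^ i = (-1) ^ (p + of_bool (j < i) + 1)"
    "(-1 :: 'k) ^ j = (-1) ^ (q + of_bool (i < j) + 1)"
    by (auto intro: arg_cong)
  have flip: "i < j \<longleftrightarrow> \<not> j < i" "a < c \<longleftrightarrow> \<not> c < a" using ij ne(1) by auto
  have "(-1) ^ (of_bool (c < a) + p) = t * (-1) ^ i" "(-1) ^ (of_bool (a < c) + q) = t * (-1) ^ j"
    unfolding t_def pw flip by (cases "j < i"; cases "c < a"; simp add: power_add)+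
  then have "symp_form n ?X ?Y = ((-1) ^ card (U \<inter> {1..n}) * t) * ?Z * ((-1) ^ i * ?xi - (-1) ^ j * ?xj)"
    unfolding eq p_def[symmetric] q_def[symmetric] by (simp add: algebra_simps)
  moreover have "(-1) ^ card (U \<inter> {1..n}) * t \<noteq> 0" by (simp add: t_def)
  ultimately show ?thesis by (rule that[rotated])
qed

text \<open>
  When \<open>x (U \<union> {a, c})\<close> vanishes for all choices, the previous identity is void, but pairing
  \<open>circ x (U \<union> {i})\<close> with \<open>circ x (U \<union> {i*})\<close> leaves only the square of \<open>x (U \<union> {i, i*})\<close>.
\<close>

lemma misses_isotropic:
  fixes x :: "nat set \<Rightarrow> 'k::field"
  assumes iso: "\<And>T T'. T \<in> subtransversals n \<Longrightarrow> T' \<in> subtransversals n \<Longrightarrow>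
      symp_form n (circ x T) (circ x T') = 0"
    and m: "misses n U i j"
    and zero: "\<And>c. c \<in> {j, star n j} \<Longrightarrow> x (U \<union> {i, c}) = 0"
  shows "x (U \<union> {i, star n i}) = 0"
proof -
  let ?X = "circ x (insert i U)" and ?Y = "circ x (insert (star n i) U)"
  have ij: "i \<in> {1..n}" "j \<in> {1..n}" "i \<noteq> j" using m by (auto simp: misses_def)
  then have ig: "i \<in> ground n" "j \<in> ground n" by simp_all
  have U: "i \<notin> U" "star n i \<notin> U" using m by (auto simp: misses_def)
  have "?X j = 0" "?X (star n j) = 0"
    using zero[of j] zero[of "star n j"] by (auto simp: circ_def insert_commute Un_insert_right)
  then have tj: "symp_term n ?X ?Y j = 0" by (simp add: symp_term_def)
  have "symp_form n ?X ?Y = symp_term n ?X ?Y i"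
  proof (rule symp_form_one[OF ij(1)])
    fix k assume k: "k \<in> {1..n}" "k \<noteq> i"
    then have "k = j \<or> k \<in> U \<or> star n k \<in> U" using misses_cover[OF m] by blast
    then show "symp_term n ?X ?Y k = 0"
    proof (elim disjE)
      assume "k = j"
      then show ?thesis by (simp only: tj)
    qed (simp_all add: symp_term_def circ_def)
  qed
  also have "\<dots> = - ?X (star n i) * ?Y i" by (simp add: symp_term_def circ_def)
  finally have "?X (star n i) * ?Y i = 0"
    using iso[OF misses_subtransversal[OF m, of i] misses_subtransversal[OF m, of "star n i"]] by simp
  then show ?thesis using U star_neq[OF ig(1)]
    by (auto simp: circ_def insert_commute Un_insert_right)
qed

lemma coord_relation_of_isotropic:
  fixes x :: "nat set \<Rightarrow> 'k::field"
  assumes iso: "\<And>T T'. T \<in> subtransversals n \<Longrightarrow> T' \<in> subtransversals n \<Longrightarrow>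
      symp_form n (circ x T) (circ x T') = 0"
    and m: "misses n U i j"
  shows "(-1) ^ i * x (U \<union> {i, star n i}) = (-1) ^ j * x (U \<union> {j, star n j})"
proof (cases "\<exists>a\<in>{i, star n i}. \<exists>c\<in>{j, star n j}. x (U \<union> {a, c}) \<noteq> 0")
  case True
  then obtain a c where ac: "a \<in> {i, star n i}" "c \<in> {j, star n j}" "x (U \<union> {a, c}) \<noteq> 0" by blast
  obtain \<sigma> :: 'k where "\<sigma> \<noteq> 0"
    "symp_form n (circ x (insert a U)) (circ x (insert c U)) = \<sigma> * x (U \<union> {a, c}) *
       ((-1) ^ i * x (U \<union> {i, star n i}) - (-1) ^ j * x (U \<union> {j, star n j}))"
    by (rule misses_symp_form[OF m ac(1,2)])
  moreover have "symp_form n (circ x (insert a U)) (circ x (insert c U)) = 0"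
    using misses_subtransversal[OF m ac(1)] misses_subtransversal[OF misses_sym[OF m] ac(2)]
    by (rule iso)
  ultimately show ?thesis using ac(3) by simp
next
  case False
  then have "x (U \<union> {i, star n i}) = 0"
    by (intro misses_isotropic[OF iso m]) auto
  moreover have "x (U \<union> {j, star n j}) = 0"
    using False by (intro misses_isotropic[OF iso misses_sym[OF m]]) (auto simp: insert_commute)
  ultimately show ?thesis by simp
qed

section \<open>Consequences of the quadrics\<close>

lemma restricted_GP_iff:
  "restricted_GP n x \<longleftrightarrow> (\<forall>S T. S \<subseteq> ground n \<longrightarrow> card S = n + 1 \<longrightarrow> one_skew_pair n S \<longrightarrow>
    T \<in> subtransversals n \<longrightarrow> (\<Sum>e\<in>S. (-1) ^ rank_in S e * circ x T e * x (S - {e})) = 0)"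
proof -
  have "(\<Sum>e\<in>S. (-1) ^ rank_in S e * circ x T e * x (S - {e})) =
    (\<Sum>e\<in>S - T. (-1) ^ (rank_in S e + rank_in T e) * x (S - {e}) * x (T \<union> {e}))"
    if "S \<subseteq> ground n" for S T
  proof -
    have "finite S" using that finite_subset[OF _ finite_ground] by blast
    then show ?thesis
      by (intro sum.mono_neutral_cong_right) (auto simp: circ_def power_add)
  qed
  then show ?thesis unfolding restricted_GP_def subtransversals_def by auto
qed

lemma restricted_GP_scale:
  assumes "restricted_GP n x"
  shows "restricted_GP n (fun_scale c x)"
proof -
  have "(\<Sum>e\<in>S. (-1) ^ rank_in S e * circ (fun_scale c x) T e * fun_scale c x (S - {e})) =
    c * c * (\<Sum>e\<in>S. (-1) ^ rank_in S e * circ x T e * x (S - {e}))" for S T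
    unfolding sum_distrib_left by (intro sum.cong) (auto simp: circ_def fun_scale_apply)
  then show ?thesis using assms unfolding restricted_GP_iff by auto
qed

text \<open>
  Induction on \<open>card (A - B)\<close>: the relation for \<open>S = B \<union> {e}\<close> and \<open>T = A - {e}\<close> expresses
  \<open>x A * x B\<close> by coordinates at sets closer to \<open>B\<close>.
\<close>

lemma restricted_GP_unique:
  fixes x y :: "nat set \<Rightarrow> 'k::field"
  assumes x: "restricted_GP n x" and y: "restricted_GP n y" and B: "B \<in> transversals n"
    and eqB: "x B = y B" "x B \<noteq> 0"
    and near: "\<And>b. b \<in> B \<Longrightarrow> circ x (B - {b}) = circ y (B - {b})"
    and A: "A \<in> coord_sets n"
  shows "x A = y A"
  using A
proof (induction "card (A - B)" arbitrary: A rule: less_induct)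
  case less
  show ?case
  proof (cases "A = B")
    case False
    obtain e where e: "e \<in> A" "e \<notin> B" "no_skew_pair n (A - {e})"
      using coord_set_exchange[OF less.prems B False] .
    have A: "A \<subseteq> ground n" "card A = n" using less.prems[unfolded coord_sets_iff] by blast+
    have Bg: "B \<subseteq> ground n" "card B = n" using B by (auto simp: transversals_def)
    have fin: "finite A" "finite B" using A Bg finite_subset[OF _ finite_ground] by blast+
    let ?T = "A - {e}" and ?S = "insert e B"
    have T: "?T \<in> subtransversals n"
      using A e fin card_Suc_Diff1[OF fin(1) e(1)] by (auto simp: subtransversals_def)
    have S: "?S \<subseteq> ground n" "card ?S = n + 1" "one_skew_pair n ?S"
      using A Bg e fin one_skew_pair_insert_transversal[OF B] by auto
    let ?g = "\<lambda>z f. (-1) ^ rank_in ?S f * circ z ?T f * z (?S - {f})"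
    have gp: "?g z e = - (\<Sum>f\<in>B. ?g z f)" if "restricted_GP n z" for z :: "nat set \<Rightarrow> 'k"
    proof -
      have "(\<Sum>f\<in>?S. ?g z f) = 0"
        using that S T unfolding restricted_GP_iff by blast
      then show ?thesis using fin e by (simp add: eq_neg_iff_add_eq_0)
    qed
    \<comment> \<open>The set \<open>?S - {f}\<close> arises from \<open>B\<close> by exchanging
      \<open>f\<close> for \<open>e\<close>, so \<open>near\<close> applies. In
      \<open>insert f ?T\<close> the element \<open>e\<close> outside \<open>B\<close> has been
      replaced by \<open>f\<close> in \<open>B\<close>, so the induction hypothesis applies, unless
      \<open>f\<close> lies in \<open>?T\<close>, where both sides vanish.\<close>
    have "?g x f = ?g y f" if f: "f \<in> B" for f
    proof -
      have "circ x (B - {f}) e = circ y (B - {f}) e" using near[OF f] by simp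
      then have "x (insert e (B - {f})) = y (insert e (B - {f}))"
        using e(2) by (simp add: circ_def)
      moreover have "?S - {f} = insert e (B - {f})" using e f by auto
      moreover have "circ x ?T f = circ y ?T f"
      proof (cases "f \<in> ?T")
        case False
        have fne: "f \<noteq> e" using e f by auto
        have fT: "insert f ?T - B = (A - B) - {e}" using f by auto
        have "card (insert f ?T - B) < card (A - B)"
          unfolding fT using e fin by (intro card_Diff1_less) auto
        moreover have "insert f ?T \<in> coord_sets n"
          using insert_in_coord_sets[of ?T n f] T f Bg False by (auto simp: subtransversals_def)
        ultimately show ?thesis using less.hyps by (simp add: circ_def)
      qed (simp add: circ_def)
      ultimately show ?thesis by simp
    qed
    then have "?g x e = ?g y e" unfolding gp[OF x] gp[OF y] by (intro arg_cong[of _ _ uminus] sum.cong) auto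
    moreover have "?S - {e} = B" "insert e ?T = A" using e by auto
    ultimately show ?thesis using eqB by (simp add: circ_def)
  qed (use eqB in simp)
qed

text \<open>
  If all transversal coordinates vanish, the relation for \<open>S = U \<union> {i, i*, j*}\<close> and
  \<open>T = U \<union> {j}\<close> reduces to \<open>x (U \<union> {i, i*}) * x (U \<union> {j, j*}) = 0\<close>, and these two
  coordinates agree up to sign.
\<close>

lemma restricted_GP_transversal_nonzero:
  fixes x :: "nat set \<Rightarrow> 'k::field"
  assumes gp: "restricted_GP n x" and x: "x \<in> coord_space n" "x \<noteq> 0"
  obtains B where "B \<in> transversals n" "x B \<noteq> 0"
proof (rule ccontr)
  assume "\<not> thesis"
  then have z: "x B = 0" if "B \<in> transversals n" for B using that \<open>\<And>B. B \<in> transversals n \<Longrightarrow> x B \<noteq> 0 \<Longrightarrow> thesis\<close> by blast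
  obtain A where A: "x A \<noteq> 0" using x(2) by (auto simp: fun_eq_iff)
  then have "A \<in> almost_transversals n" using z x(1) by (auto simp: coord_space_def supported_on_def)
  then obtain U i j where m: "misses n U i j" and AU: "A = U \<union> {i, star n i}"
    by (rule almost_transversalE)
  have ij: "i \<in> {1..n}" "j \<in> {1..n}" "i \<noteq> j" using m by (auto simp: misses_def)
  then have ig: "i \<in> ground n" "j \<in> ground n" by simp_all
  have U: "i \<notin> U" "star n i \<notin> U" "j \<notin> U" "star n j \<notin> U" using m by (auto simp: misses_def)
  have ne: "i \<noteq> j" "star n i \<noteq> i" "star n j \<noteq> j" "star n i \<noteq> j" "star n j \<noteq> i" "star n i \<noteq> star n j"
    using ij by (auto simp: star_def)
  \<comment> \<open>Since \<open>?C\<close> is a transversal, \<open>?S\<close> has one skew pair,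
    and removing \<open>i\<close> or \<open>star n i\<close> from \<open>?S\<close> leaves a
    transversal. As \<open>circ x ?T\<close> vanishes on \<open>U\<close>, only the summand at
    \<open>star n j\<close> can be nonzero.\<close>
  let ?C = "U \<union> {i, star n j}" and ?T = "insert j U"
  let ?S = "insert (star n i) ?C"
  have C: "?C \<in> transversals n" using misses_transversal[OF m] by simp
  have nC: "star n i \<notin> ?C" using U ne by auto
  have fC: "finite ?C" using misses_finite[OF m] by simp
  have S: "?S \<subseteq> ground n" "card ?S = n + 1" "one_skew_pair n ?S"
    using one_skew_pair_insert_transversal[OF C star_in_ground[OF ig(1)] nC] C nC fC ig
    by (auto simp: transversals_def)
  have T: "?T \<in> subtransversals n" using misses_subtransversal[OF misses_sym[OF m]] by simp
  let ?g = "\<lambda>e. (-1) ^ rank_in ?S e * circ x ?T e * x (?S - {e})"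
  have "0 = sum ?g ?S" by (rule gp[unfolded restricted_GP_iff, rule_format, OF S T, symmetric])
  also have "\<dots> = sum ?g {star n j}"
  proof (rule sum.mono_neutral_right)
    show "finite ?S" using fC by simp
    show "{star n j} \<subseteq> ?S" by simp
    show "\<forall>e\<in>?S - {star n j}. ?g e = 0"
    proof
      fix e assume "e \<in> ?S - {star n j}"
      then consider "e \<in> U" | "e = i" | "e = star n i" by blast
      then show "?g e = 0"
      proof cases
        case 1
        then show ?thesis by (simp add: circ_def)
      next
        case 2
        have "?S - {i} = U \<union> {star n i, star n j}" using U ne by auto
        then show ?thesis using z[OF misses_transversal[OF m, of "star n i" "star n j"]] 2 by simp
      next
        case 3
        have "?S - {star n i} = ?C" using U ne by auto
        then show ?thesis using z[OF C] 3 by simp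
      qed
    qed
  qed
  finally have "circ x ?T (star n j) * x (?S - {star n j}) = 0" by simp
  moreover have "?S - {star n j} = A" unfolding AU using U ne by auto
  moreover have "insert (star n j) ?T = U \<union> {j, star n j}" by auto
  ultimately have "x (U \<union> {j, star n j}) = 0" using A U ne by (simp add: circ_def)
  moreover have "(-1) ^ i * x A = (-1) ^ j * x (U \<union> {j, star n j})"
    using x(1) m unfolding coord_space_iff AU by blast
  ultimately show False using A by simp
qed

section \<open>Lagrangian subspaces\<close>

lemma symp_form_add: "symp_form n X (Y + Z) = symp_form n X Y + symp_form n X Z"
  by (simp add: symp_form_def sum.distrib[symmetric] algebra_simps)

lemma symp_form_scale: "symp_form n X (fun_scale c Y) = c * symp_form n X Y"
  by (simp add: symp_form_def sum_distrib_left fun_scale_apply algebra_simps)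

lemma symp_form_zero: "symp_form n X 0 = 0"
  by (simp add: symp_form_def)

text \<open>The two products in each summand cancel, so this holds in characteristic two as well,
  where it would not follow from \<open>symp_form_swap\<close>.\<close>

lemma symp_form_self: "symp_form n X X = 0"
  by (simp add: symp_form_def)

lemma symp_form_swap: "symp_form n Y X = - symp_form n X Y"
  by (simp add: symp_form_def sum_negf[symmetric] algebra_simps)

lemma symp_form_span_right:
  assumes "Y \<in> fun_space.span A" "\<And>Z. Z \<in> A \<Longrightarrow> symp_form n X Z = 0"
  shows "symp_form n X Y = 0"
  using assms(1)
proof (induction rule: fun_space.span_induct_alt)
  case base
  then show ?case by (rule symp_form_zero)
next
  case (step c Z Y)
  then show ?case by (simp only: symp_form_add symp_form_scale assms(2)) simp
qed

lemma symp_form_span: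
  assumes "\<And>Y Z. Y \<in> A \<Longrightarrow> Z \<in> A \<Longrightarrow> symp_form n Y Z = 0"
    and "X \<in> fun_space.span A" "Y \<in> fun_space.span A"
  shows "symp_form n X Y = 0"
proof (rule symp_form_span_right[OF assms(3)])
  fix Z assume Z: "Z \<in> A"
  have "symp_form n Z X = 0" using symp_form_span_right[OF assms(2)] assms(1) Z by blast
  then show "symp_form n X Z = 0" by (simp add: symp_form_swap[of n X Z])
qed

section \<open>Subspaces and their coordinates on a subset\<close>

lemma subspace_supported_on: "fun_space.subspace (supported_on I)"
  by (auto simp: fun_space.subspace_def supported_on_def fun_scale_apply)

text \<open>Injectivity of the projection of \<open>W\<close> to the coordinates in
  \<open>B\<close>. For an \<open>n\<close>-dimensional row space and \<open>card B = n\<close> it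
  is equivalent to a nonzero minor at \<open>B\<close>, but it does not refer to a matrix.\<close>

definition determined_on :: "'a set \<Rightarrow> ('a \<Rightarrow> 'k::field) set \<Rightarrow> bool" where
  "determined_on B W \<longleftrightarrow> (\<forall>w\<in>W. (\<forall>b\<in>B. w b = 0) \<longrightarrow> w = 0)"

lemma determined_onD: "determined_on B W \<Longrightarrow> w \<in> W \<Longrightarrow> (\<And>b. b \<in> B \<Longrightarrow> w b = 0) \<Longrightarrow> w = 0"
  by (auto simp: determined_on_def)

text \<open>A diagonal matrix on \<open>B\<close>, not normalised because
  \<open>circ x (B - {b})\<close> has the entry \<open>x B\<close> up to sign at \<open>b\<close>.
  The index type is general since such frames also give the dimension of the space of
  coordinates.\<close>

definition dual_frame :: "'a set \<Rightarrow> ('a \<Rightarrow> 'a \<Rightarrow> 'k::field) \<Rightarrow> bool" where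
  "dual_frame B v \<longleftrightarrow> finite B \<and> (\<forall>b\<in>B. v b b \<noteq> 0 \<and> (\<forall>c\<in>B. c \<noteq> b \<longrightarrow> v b c = 0))"

context
  fixes B :: "'a set" and v :: "'a \<Rightarrow> 'a \<Rightarrow> 'k::field"
  assumes frame: "dual_frame B v"
begin

lemma dual_frame_finite: "finite B"
  and dual_frame_off_diag: "b \<in> B \<Longrightarrow> c \<in> B \<Longrightarrow> c \<noteq> b \<Longrightarrow> v b c = 0"
  and dual_frame_diag: "b \<in> B \<Longrightarrow> v b b \<noteq> 0"
  using frame by (auto simp: dual_frame_def)

lemma dual_frame_sum: "b \<in> B \<Longrightarrow> (\<Sum>c\<in>B. fun_scale (f c) (v c)) b = f b * v b b"
proof -
  assume b: "b \<in> B"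
  have "(\<Sum>c\<in>B. fun_scale (f c) (v c)) b = (\<Sum>c\<in>B. f c * v c b)"
    by (simp add: sum_fun_apply fun_scale_apply)
  also have "\<dots> = (\<Sum>c\<in>{b}. f c * v c b)"
    using b dual_frame_finite dual_frame_off_diag by (intro sum.mono_neutral_right) auto
  finally show ?thesis by simp
qed

lemma dual_frame_inj: "inj_on v B"
proof (rule inj_onI)
  fix b c assume "b \<in> B" "c \<in> B" "v b = v c"
  then show "b = c" using dual_frame_off_diag[of c b] dual_frame_diag[of b] by metis
qed

lemma dual_frame_independent: "fun_space.independent (v ` B)"
proof (rule fun_space.independent_if_scalars_zero)
  fix f x assume s: "(\<Sum>x\<in>v ` B. fun_scale (f x) x) = 0" and "x \<in> v ` B"
  then obtain b where b: "b \<in> B" "x = v b" by blast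
  have "(\<Sum>c\<in>B. fun_scale (f (v c)) (v c)) = 0"
    using s by (simp add: sum.reindex[OF dual_frame_inj])
  then have "f (v b) * v b b = 0" using dual_frame_sum[OF b(1), of "\<lambda>c. f (v c)"] by simp
  then show "f x = 0" using b dual_frame_diag by simp
qed (use dual_frame_finite in simp)

lemma dual_frame_dim: "fun_space.dim (fun_space.span (v ` B)) = card B"
  using fun_space.dim_span_eq_card_independent[OF dual_frame_independent]
    card_image[OF dual_frame_inj] by simp

lemma dual_frame_determined: "determined_on B (fun_space.span (v ` B))"
proof -
  have ex: "\<exists>f. w = (\<Sum>c\<in>B. fun_scale (f c) (v c))" if "w \<in> fun_space.span (v ` B)" for w
    using that
  proof (induction rule: fun_space.span_induct_alt)
    case base
    then show ?case by (intro exI[of _ "\<lambda>_. 0"]) simp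
  next
    case (step c x y)
    then obtain f b where f: "y = (\<Sum>c\<in>B. fun_scale (f c) (v c))" and b: "b \<in> B" "x = v b" by blast
    have "(\<Sum>c'\<in>B. fun_scale (of_bool (c' = b) * c) (v c')) = fun_scale c x"
    proof -
      have "(\<Sum>c'\<in>B. fun_scale (of_bool (c' = b) * c) (v c')) = (\<Sum>c'\<in>{b}. fun_scale (of_bool (c' = b) * c) (v c'))"
        using b dual_frame_finite by (intro sum.mono_neutral_right) auto
      then show ?thesis using b by simp
    qed
    then have "fun_scale c x + y = (\<Sum>c'\<in>B. fun_scale (of_bool (c' = b) * c + f c') (v c'))"
      unfolding f by (simp only: fun_space.scale_left_distrib sum.distrib)
    then show ?case by (rule exI[of _ "\<lambda>c'. of_bool (c' = b) * c + f c'"])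
  qed
  have "w = 0" if w: "w \<in> fun_space.span (v ` B)" "\<And>b. b \<in> B \<Longrightarrow> w b = 0" for w
  proof -
    obtain f where f: "w = (\<Sum>c\<in>B. fun_scale (f c) (v c))" using ex[OF w(1)] by blast
    have "f b = 0" if "b \<in> B" for b
      using w(2)[OF that] dual_frame_sum[OF that, of f] dual_frame_diag[OF that] by (simp add: f)
    then show ?thesis unfolding f by simp
  qed
  then show ?thesis by (simp add: determined_on_def)
qed

text \<open>The frame interpolates the values of \<open>w\<close> on \<open>B\<close>, and
  \<open>u\<close> is the difference. That \<open>u\<close> is zero has to come from elsewhere: from
  \<open>determined_on\<close>, or from isotropy when maximality is shown.\<close>

lemma dual_frame_remainder:
  assumes W: "fun_space.subspace W" "\<And>b. b \<in> B \<Longrightarrow> v b \<in> W" and w: "w \<in> W"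
  obtains u where "u \<in> W" "\<And>b. b \<in> B \<Longrightarrow> u b = 0" "w - u \<in> fun_space.span (v ` B)"
proof
  let ?s = "\<Sum>b\<in>B. fun_scale (w b / v b b) (v b)"
  have s: "?s \<in> fun_space.span (v ` B)"
    by (intro fun_space.span_sum fun_space.span_scale fun_space.span_base) auto
  then show "w - (w - ?s) \<in> fun_space.span (v ` B)" by simp
  have "?s \<in> W" using W by (intro fun_space.subspace_sum fun_space.subspace_scale) auto
  then show "w - ?s \<in> W" using W w by (intro fun_space.subspace_diff)
  show "(w - ?s) b = 0" if "b \<in> B" for b
    using dual_frame_sum[OF that, of "\<lambda>b. w b / v b b"] dual_frame_diag[OF that] by simp
qed

lemma dual_frame_span_eq:
  assumes W: "fun_space.subspace W" "\<And>b. b \<in> B \<Longrightarrow> v b \<in> W" and det: "determined_on B W"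
  shows "fun_space.span (v ` B) = W"
proof (rule fun_space.span_subspace)
  show "W \<subseteq> fun_space.span (v ` B)"
  proof
    fix w assume "w \<in> W"
    then obtain u where u: "u \<in> W" "\<And>b. b \<in> B \<Longrightarrow> u b = 0" "w - u \<in> fun_space.span (v ` B)"
      using dual_frame_remainder[OF W] by metis
    then show "w \<in> fun_space.span (v ` B)" using determined_onD[OF det u(1,2)] by simp
  qed
qed (use W in auto)

end

section \<open>Row spaces and nonvanishing minors\<close>

lemma row_space_combination:
  assumes "w \<in> row_space n \<Lambda>"
  obtains c where "w = (\<Sum>k<n. fun_scale (c k) (\<Lambda> (Suc k)))"
proof -
  have "\<exists>c. w = (\<Sum>k<n. fun_scale (c k) (\<Lambda> (Suc k)))"
    using assms unfolding row_space_def
  proof (induction rule: fun_space.span_induct_alt)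
    case base
    then show ?case by (intro exI[of _ "\<lambda>_. 0"]) simp
  next
    case (step d x y)
    then obtain c where c: "y = (\<Sum>k<n. fun_scale (c k) (\<Lambda> (Suc k)))" by blast
    from step(1) obtain r where "x = \<Lambda> r" "r \<in> {1..n}" by blast
    then obtain l where l: "l < n" "x = \<Lambda> (Suc l)" by (cases r) (auto simp: less_eq_Suc_le)
    have "(\<Sum>k<n. fun_scale (of_bool (k = l) * d) (\<Lambda> (Suc k))) =
      (\<Sum>k\<in>{l}. fun_scale (of_bool (k = l) * d) (\<Lambda> (Suc k)))"
      using l by (intro sum.mono_neutral_right) auto
    also have "\<dots> = fun_scale d x" using l by simp
    finally have "fun_scale d x + y = (\<Sum>k<n. fun_scale (of_bool (k = l) * d + c k) (\<Lambda> (Suc k)))"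
      unfolding c by (simp only: fun_space.scale_left_distrib sum.distrib)
    then show ?case by (rule exI[of _ "\<lambda>k. of_bool (k = l) * d + c k"])
  qed
  then show ?thesis using that by blast
qed

text \<open>Passing to the transpose turns a kernel vector into coefficients of a combination of
  rows. This combination may be the zero vector, as the rows of \<open>\<Lambda>\<close> can be
  dependent; the assumption on the dimension in \<open>full_minor_nonzero\<close> excludes
  that.\<close>

lemma left_kernel_submatrix_iff:
  fixes \<Lambda> :: "nat \<Rightarrow> nat \<Rightarrow> 'k::field"
  assumes B: "finite B" "card B = n"
  shows "full_minors n \<Lambda> B = 0 \<longleftrightarrow>
    (\<exists>c. (\<exists>k<n. c k \<noteq> 0) \<and> (\<forall>b\<in>B. (\<Sum>k<n. c k * \<Lambda> (Suc k) b) = 0))"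
proof -
  let ?xs = "sorted_list_of_set B"
  let ?M = "transpose_mat (submatrix n \<Lambda> B)"
  have sub: "submatrix n \<Lambda> B \<in> carrier_mat n n" by (simp add: submatrix_def)
  then have M: "?M \<in> carrier_mat n n" by simp
  have row: "(?M *\<^sub>v v) $ i = (\<Sum>k<n. v $ k * \<Lambda> (Suc k) (?xs ! i))"
    if "i < n" "v \<in> carrier_vec n" for v i
    using that by (auto simp: submatrix_def scalar_prod_def lessThan_atLeast0 mult.commute intro!: sum.cong)
  have all_iff: "(\<forall>b\<in>B. P b) \<longleftrightarrow> (\<forall>i<n. P (?xs ! i))" for P
    using B by (metis in_set_conv_nth length_sorted_list_of_set set_sorted_list_of_set)
  have "full_minors n \<Lambda> B = 0 \<longleftrightarrow> det ?M = 0" using det_transpose[OF sub] by simp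
  also have "\<dots> \<longleftrightarrow> (\<exists>v. v \<in> carrier_vec n \<and> v \<noteq> 0\<^sub>v n \<and> ?M *\<^sub>v v = 0\<^sub>v n)"
    by (rule det_0_iff_vec_prod_zero_field[OF M])
  also have "\<dots> \<longleftrightarrow> (\<exists>c. (\<exists>k<n. c k \<noteq> 0) \<and> (\<forall>b\<in>B. (\<Sum>k<n. c k * \<Lambda> (Suc k) b) = 0))"
  proof
    assume "\<exists>v. v \<in> carrier_vec n \<and> v \<noteq> 0\<^sub>v n \<and> ?M *\<^sub>v v = 0\<^sub>v n"
    then obtain v where v: "v \<in> carrier_vec n" "v \<noteq> 0\<^sub>v n" "?M *\<^sub>v v = 0\<^sub>v n" by blast
    have "\<exists>k<n. v $ k \<noteq> 0"
    proof (rule ccontr)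
      assume "\<not> (\<exists>k<n. v $ k \<noteq> 0)"
      then have "v = 0\<^sub>v n" using v(1) by (intro eq_vecI) auto
      then show False using v(2) by simp
    qed
    moreover have "(\<Sum>k<n. v $ k * \<Lambda> (Suc k) (?xs ! i)) = 0" if "i < n" for i
      using row[OF that v(1)] v(3) that by simp
    ultimately show "\<exists>c. (\<exists>k<n. c k \<noteq> 0) \<and> (\<forall>b\<in>B. (\<Sum>k<n. c k * \<Lambda> (Suc k) b) = 0)"
      unfolding all_iff by (intro exI[of _ "\<lambda>k. v $ k"]) simp
  next
    assume "\<exists>c. (\<exists>k<n. c k \<noteq> 0) \<and> (\<forall>b\<in>B. (\<Sum>k<n. c k * \<Lambda> (Suc k) b) = 0)"
    then obtain c where c: "\<exists>k<n. c k \<noteq> 0" "\<And>i. i < n \<Longrightarrow> (\<Sum>k<n. c k * \<Lambda> (Suc k) (?xs ! i)) = 0"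
      unfolding all_iff by blast
    have v: "vec n c \<in> carrier_vec n" by simp
    have "vec n c \<noteq> 0\<^sub>v n"
    proof
      assume eq: "vec n c = 0\<^sub>v n"
      obtain k where "k < n" "c k \<noteq> 0" using c(1) by blast
      then show False using arg_cong[OF eq, of "\<lambda>v. v $ k"] by simp
    qed
    moreover have "?M *\<^sub>v vec n c = 0\<^sub>v n"
    proof (rule eq_vecI)
      fix i assume "i < dim_vec (0\<^sub>v n :: 'k vec)"
      then have i: "i < n" by simp
      show "(?M *\<^sub>v vec n c) $ i = 0\<^sub>v n $ i" using row[OF i v] c(2)[OF i] i by simp
    qed (use M in simp)
    ultimately show "\<exists>v. v \<in> carrier_vec n \<and> v \<noteq> 0\<^sub>v n \<and> ?M *\<^sub>v v = 0\<^sub>v n" using v by blast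
  qed
  finally show ?thesis .
qed

lemma row_space_determined_on:
  fixes \<Lambda> :: "nat \<Rightarrow> nat \<Rightarrow> 'k::field"
  assumes B: "finite B" "card B = n" and nz: "full_minors n \<Lambda> B \<noteq> 0"
  shows "determined_on B (row_space n \<Lambda>)"
  unfolding determined_on_def
proof (intro ballI impI)
  fix w assume w: "w \<in> row_space n \<Lambda>" "\<forall>b\<in>B. w b = 0"
  obtain c where c: "w = (\<Sum>k<n. fun_scale (c k) (\<Lambda> (Suc k)))" using row_space_combination[OF w(1)] .
  have "\<forall>b\<in>B. (\<Sum>k<n. c k * \<Lambda> (Suc k) b) = 0"
    using w(2) unfolding c by (simp add: sum_fun_apply fun_scale_apply)
  then have "\<forall>k<n. c k = 0" using nz unfolding left_kernel_submatrix_iff[OF B] by blast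
  then show "w = 0" unfolding c by simp
qed

text \<open>A vanishing minor yields a nontrivial combination of the rows that is zero on
  \<open>B\<close>, hence everywhere. Some row is then spanned by the others, and at most
  \<open>n - 1\<close> vectors would span a space of dimension \<open>n\<close>.\<close>

lemma full_minor_nonzero:
  fixes \<Lambda> :: "nat \<Rightarrow> nat \<Rightarrow> 'k::field"
  assumes B: "finite B" "card B = n" and det: "determined_on B (row_space n \<Lambda>)"
    and dim: "fun_space.dim (row_space n \<Lambda>) = n"
  shows "full_minors n \<Lambda> B \<noteq> 0"
proof
  assume "full_minors n \<Lambda> B = 0"
  then obtain c k where c: "\<forall>b\<in>B. (\<Sum>k<n. c k * \<Lambda> (Suc k) b) = 0" and k: "k < n" "c k \<noteq> 0"
    unfolding left_kernel_submatrix_iff[OF B] by blast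
  let ?w = "\<Sum>k<n. fun_scale (c k) (\<Lambda> (Suc k))"
  have "?w \<in> row_space n \<Lambda>"
    unfolding row_space_def by (intro fun_space.span_sum fun_space.span_scale fun_space.span_base) auto
  then have w0: "?w = 0"
    using c by (intro determined_onD[OF det]) (simp_all add: sum_fun_apply fun_scale_apply)
  let ?R = "\<Lambda> ` ({1..n} - {Suc k})"
  have "?w = fun_scale (c k) (\<Lambda> (Suc k)) + (\<Sum>l\<in>{..<n} - {k}. fun_scale (c l) (\<Lambda> (Suc l)))"
    using k by (intro sum.remove) auto
  then have "fun_scale (c k) (\<Lambda> (Suc k)) = - (\<Sum>l\<in>{..<n} - {k}. fun_scale (c l) (\<Lambda> (Suc l)))"
    using w0 by (simp add: eq_neg_iff_add_eq_0)
  also have "\<dots> \<in> fun_space.span ?R"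
    by (intro fun_space.span_neg fun_space.span_sum fun_space.span_scale fun_space.span_base) auto
  finally have "fun_scale (inverse (c k)) (fun_scale (c k) (\<Lambda> (Suc k))) \<in> fun_space.span ?R"
    by (rule fun_space.span_scale)
  then have "\<Lambda> (Suc k) \<in> fun_space.span ?R" using k by simp
  moreover have "\<Lambda> r \<in> fun_space.span ?R" if "r \<in> {1..n}" "r \<noteq> Suc k" for r
    using that by (intro fun_space.span_base) auto
  ultimately have "\<Lambda> ` {1..n} \<subseteq> fun_space.span ?R" by blast
  then have "row_space n \<Lambda> \<subseteq> fun_space.span ?R"
    unfolding row_space_def by (rule fun_space.span_minimal) simp
  then have "fun_space.dim (row_space n \<Lambda>) \<le> card ?R" by (rule fun_space.dim_le_card) simp
  then have "n \<le> card ?R" by (simp only: dim)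
  also have "\<dots> \<le> card ({1..n} - {Suc k})" by (rule card_image_le) simp
  also have "\<dots> < n" using k by simp
  finally show False by simp
qed

text \<open>
  Take \<open>I \<subseteq> {1..n}\<close> maximal such that \<open>W\<close> projects onto \<open>k\<^sup>I\<close>, and complete it by the
  starred elements of the other indices.
\<close>

lemma isotropic_determined_on_transversal:
  fixes W :: "(nat \<Rightarrow> 'k::field) set"
  assumes W: "isotropic_subspace n W"
  obtains B where "B \<in> transversals n" "determined_on B W"
proof -
  have sub: "fun_space.subspace W" and supp: "W \<subseteq> supported_on (ground n)"
    and iso: "\<And>X Y. X \<in> W \<Longrightarrow> Y \<in> W \<Longrightarrow> symp_form n X Y = 0"
    using W by (auto simp: isotropic_subspace_def)
  \<comment> \<open>Surjectivity onto the coordinates in \<open>I\<close>, expressed by preimages of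
    the unit vectors.\<close>
  define P where "P I \<longleftrightarrow> I \<subseteq> {1..n} \<and> (\<forall>i\<in>I. \<exists>v\<in>W. v i = 1 \<and> (\<forall>k\<in>I - {i}. v k = 0))" for I
  have "finite (Collect P)" by (rule finite_subset[of _ "Pow {1..n}"]) (use P_def in blast, simp)
  moreover have "{} \<in> Collect P" by (simp add: P_def)
  ultimately obtain I where I: "P I" and max: "\<And>J. P J \<Longrightarrow> I \<subseteq> J \<Longrightarrow> J = I"
    using finite_has_maximal[of "Collect P"] by blast
  have In: "I \<subseteq> {1..n}" using I by (simp add: P_def)
  have low: "w j = 0" if w: "w \<in> W" "\<And>i. i \<in> I \<Longrightarrow> w i = 0" and j: "j \<in> {1..n}" for w j
  proof (rule ccontr)
    assume nz: "w j \<noteq> 0"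
    then have jI: "j \<notin> I" using w(2) by blast
    \<comment> \<open>A vector \<open>w\<close> that vanishes on \<open>I\<close> but not at
      \<open>j\<close> extends the system: normalised it serves for \<open>j\<close>, and its
      multiples clear the entries at \<open>j\<close> of the other vectors.\<close>
    have "P (insert j I)"
      unfolding P_def
    proof (intro conjI ballI)
      show "insert j I \<subseteq> {1..n}" using In j by simp
      fix i assume i: "i \<in> insert j I"
      show "\<exists>v\<in>W. v i = 1 \<and> (\<forall>k\<in>insert j I - {i}. v k = 0)"
      proof (cases "i = j")
        case True
        then show ?thesis using nz w jI
          by (intro bexI[of _ "fun_scale (1 / w j) w"])
            (auto simp: fun_scale_apply intro: fun_space.subspace_scale[OF sub])
      next
        case False
        then obtain v where v: "v \<in> W" "v i = 1" "\<forall>k\<in>I - {i}. v k = 0"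
          using i I by (auto simp: P_def)
        have "v - fun_scale (v j / w j) w \<in> W"
          by (intro fun_space.subspace_diff fun_space.subspace_scale sub v w)
        then show ?thesis using v False i nz w(2)
          by (intro bexI[of _ "v - fun_scale (v j / w j) w"]) (auto simp: fun_scale_apply)
      qed
    qed
    then show False using max jI by blast
  qed
  let ?B = "I \<union> star n ` ({1..n} - I)"
  have inj: "inj_on (star n) ({1..n} - I)" by (auto simp: inj_on_def star_def)
  have disj: "I \<inter> star n ` ({1..n} - I) = {}" using In by (auto simp: star_def)
  have "card ?B = card I + card ({1..n} - I)"
    using In disj inj by (subst card_Un_disjoint) (auto simp: finite_subset card_image)
  also have "\<dots> = n" using In card_mono[OF _ In] by (simp add: card_Diff_subset finite_subset)
  finally have "card ?B = n" .
  moreover have In': "1 \<le> i \<and> i \<le> n" if "i \<in> I" for i using In that by auto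
  moreover have "n + i \<notin> I" if "i \<in> I" for i using In'[of i] In'[of "n + i"] that by auto
  ultimately have "?B \<in> transversals n"
    unfolding transversals_iff by (auto simp: star_def ground_def dest: In')
  moreover have "determined_on ?B W"
    unfolding determined_on_def
  proof (intro ballI impI)
    fix w assume w: "w \<in> W" "\<forall>b\<in>?B. w b = 0"
    have lo: "w k = 0" if "k \<in> {1..n}" for k using low[OF w(1) _ that] w(2) by blast
    have hi: "w (star n k) = 0" if k: "k \<in> {1..n}" for k
    proof (cases "k \<in> I")
      case False
      then show ?thesis using w(2) k by blast
    next
      case True
      then obtain v where v: "v \<in> W" "v k = 1" "\<forall>i\<in>I - {k}. v i = 0"
        using I by (auto simp: P_def)
      \<comment> \<open>\<open>w\<close> vanishes at all unstarred elements and at the partners of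
        indices outside \<open>I\<close>, while \<open>v\<close> vanishes on the rest of
        \<open>I\<close>. So pairing with \<open>v\<close> isolates
        \<open>w (star n k)\<close>.\<close>
      have "symp_form n v w = symp_term n v w k"
      proof (rule symp_form_one[OF k])
        fix i assume i: "i \<in> {1..n}" "i \<noteq> k"
        have "v i * w (star n i) = 0"
        proof (cases "i \<in> I")
          case True
          then show ?thesis using v(3) i by simp
        next
          case False
          then show ?thesis using w(2) i by simp
        qed
        then show "symp_term n v w i = 0" using lo[OF i(1)] by (simp add: symp_term_def)
      qed
      then show ?thesis using iso[OF v(1) w(1)] lo[OF k] v(2) by (simp add: symp_term_def)
    qed
    show "w = 0"
    proof
      fix e
      show "w e = 0 e"
      proof (cases "e \<in> ground n")
        case True
        then show ?thesis by (cases rule: ground_cases) (use lo hi in \<open>auto simp: star_def\<close>)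
      next
        case False
        then show ?thesis using w(1) supp by (auto simp: supported_on_def)
      qed
    qed
  qed
  ultimately show ?thesis by (rule that)
qed

section \<open>Coordinate vectors of Lagrangian subspaces\<close>

lemma transversal_finite: "B \<in> transversals n \<Longrightarrow> finite B \<and> card B = n \<and> B \<in> coord_sets n"
  using finite_subset[OF _ finite_ground] by (auto simp: transversals_def)

lemma circ_transversal_off_diag:
  "b \<in> B \<Longrightarrow> c \<in> B \<Longrightarrow> c \<noteq> b \<Longrightarrow> circ x (B - {b}) c = 0"
  by (simp add: circ_def)

lemma circ_transversal_diag:
  "b \<in> B \<Longrightarrow> circ x (B - {b}) b = (-1) ^ rank_in (B - {b}) b * x B"
  by (simp add: circ_def insert_absorb)

lemma circ_dual_frame:
  assumes "finite B" "x B \<noteq> 0"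
  shows "dual_frame B (\<lambda>b. circ x (B - {b}))"
  using assms circ_transversal_off_diag circ_transversal_diag[of _ B x] by (auto simp: dual_frame_def)

lemma circ_supported:
  assumes "x \<in> supported_on (coord_sets n)"
  shows "circ x T \<in> supported_on (ground n)"
proof -
  have "x (insert e T) = 0" if "e \<notin> ground n" for e
  proof -
    have "insert e T \<notin> coord_sets n" unfolding coord_sets_iff using that by simp
    then show ?thesis using assms unfolding supported_on_def by blast
  qed
  then show ?thesis by (auto simp: supported_on_def circ_def)
qed

lemma circ_scale: "circ (fun_scale c x) T = fun_scale c (circ x T)"
  by (auto simp: circ_def fun_scale_apply)

lemma minors_supported: "minors n \<Lambda> \<in> supported_on (coord_sets n)"
  by (simp add: supported_on_def minors_def)

lemma minors_eq: "B \<in> coord_sets n \<Longrightarrow> minors n \<Lambda> B = full_minors n \<Lambda> B"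
  by (simp add: minors_def)

lemma row_space_supported: "\<Lambda> \<in> matrices n \<Longrightarrow> row_space n \<Lambda> \<subseteq> supported_on (ground n)"
  unfolding row_space_def matrices_def
  by (intro fun_space.span_minimal subspace_supported_on) auto

text \<open>For \<open>e\<close> in the ground set and not in \<open>T\<close>, the set
  \<open>insert e T\<close> indexes a coordinate, so dropping the other minors loses nothing;
  elsewhere both sides vanish.\<close>

lemma circ_minors:
  assumes \<Lambda>: "\<Lambda> \<in> matrices n" and T: "T \<in> subtransversals n"
  shows "circ (minors n \<Lambda>) T = circ (full_minors n \<Lambda>) T"
    and "circ (minors n \<Lambda>) T \<in> row_space n \<Lambda>"
proof -
  have T': "T \<subseteq> ground n" "card T + 1 = n" "no_skew_pair n T" "finite T"
    using T subtransversals_finite[OF T] unfolding subtransversals_def by blast+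
  have mem: "circ (full_minors n \<Lambda>) T \<in> row_space n \<Lambda>"
    by (rule circ_full_minors_in_row_space[OF T'(4,2)])
  show eq: "circ (minors n \<Lambda>) T = circ (full_minors n \<Lambda>) T"
  proof
    fix e
    show "circ (minors n \<Lambda>) T e = circ (full_minors n \<Lambda>) T e"
    proof (cases "e \<in> ground n")
      case True
      then show ?thesis
        using minors_eq[OF insert_in_coord_sets[OF T'(1-3) True], of \<Lambda>] by (simp add: circ_def)
    next
      case False
      moreover have "circ (minors n \<Lambda>) T \<in> supported_on (ground n)"
        by (rule circ_supported[OF minors_supported])
      moreover have "circ (full_minors n \<Lambda>) T \<in> supported_on (ground n)"
        using mem row_space_supported[OF \<Lambda>] by (rule set_mp[rotated])
      ultimately show ?thesis by (simp add: supported_on_def)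
    qed
  qed
  show "circ (minors n \<Lambda>) T \<in> row_space n \<Lambda>" using mem unfolding eq .
qed

lemma minors_restricted_GP:
  assumes \<Lambda>: "\<Lambda> \<in> matrices n"
  shows "restricted_GP n (minors n \<Lambda>)"
  unfolding restricted_GP_iff
proof (intro allI impI)
  fix S T assume S: "S \<subseteq> ground n" "card S = n + 1" "one_skew_pair n S" and T: "T \<in> subtransversals n"
  have "finite S" using S(1) finite_subset[OF _ finite_ground] by blast
  from row_space_orthogonal_minors[OF this S(2) circ_minors(2)[OF \<Lambda> T]]
  have "(\<Sum>e\<in>S. (-1) ^ rank_in S e * circ (minors n \<Lambda>) T e * full_minors n \<Lambda> (S - {e})) = 0" .
  moreover have "full_minors n \<Lambda> (S - {e}) = minors n \<Lambda> (S - {e})" if "e \<in> S" for e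
    using minors_eq[OF one_skew_pair_remove[OF S that], of \<Lambda>] by simp
  ultimately show "(\<Sum>e\<in>S. (-1) ^ rank_in S e * circ (minors n \<Lambda>) T e * minors n \<Lambda> (S - {e})) = 0"
    by (simp cong: sum.cong)
qed

lemma isotropic_minors_in_coord_space:
  assumes \<Lambda>: "\<Lambda> \<in> matrices n" and iso: "isotropic_subspace n (row_space n \<Lambda>)"
  shows "minors n \<Lambda> \<in> coord_space n"
  unfolding coord_space_iff
proof (intro conjI allI impI minors_supported)
  fix U i j assume "misses n U i j"
  then show "(-1) ^ i * minors n \<Lambda> (U \<union> {i, star n i}) = (-1) ^ j * minors n \<Lambda> (U \<union> {j, star n j})"
    using circ_minors(2)[OF \<Lambda>] iso
    by (intro coord_relation_of_isotropic) (auto simp: isotropic_subspace_def)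
qed

text \<open>\<open>B\<close> is chosen from \<open>W\<close> alone and so serves for all matrices
  with row space \<open>W\<close>, which is what comparing two of them in \<open>Phi_eq\<close>
  requires.\<close>

lemma Lag_minors_transversal:
  assumes W: "W \<in> Lag n"
  obtains B where "B \<in> transversals n" "determined_on B W"
    "\<And>\<Lambda>. row_space n \<Lambda> = W \<Longrightarrow> minors n \<Lambda> B \<noteq> 0"
proof -
  have "isotropic_subspace n W" and dim: "fun_space.dim W = n" using W by (auto simp: Lag_def)
  then obtain B where B: "B \<in> transversals n" "determined_on B W"
    using isotropic_determined_on_transversal by blast
  have "minors n \<Lambda> B \<noteq> 0" if "row_space n \<Lambda> = W" for \<Lambda>
    using full_minor_nonzero[of B n \<Lambda>] transversal_finite[OF B(1)] that dim B(2) minors_eq[of B n \<Lambda>]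
    by simp
  with B show ?thesis by (rule that)
qed

text \<open>Vectors of \<open>W\<close> are determined by their values on \<open>B\<close>, where
  \<open>circ x (B - {b})\<close> has the single entry \<open>x B\<close> up to sign. After scaling,
  \<open>x\<close> and \<open>y\<close> therefore have the same vectors, and
  \<open>restricted_GP_unique\<close> applies. For two matrices of one space this replaces the
  change of basis; for a solution and a matrix of the space built from it, it identifies the
  solution.\<close>

lemma restricted_GP_proportional:
  fixes x y :: "nat set \<Rightarrow> 'k::field"
  assumes x: "restricted_GP n x" "x \<in> supported_on (coord_sets n)"
    and y: "restricted_GP n y" "y \<in> supported_on (coord_sets n)"
    and B: "B \<in> transversals n" "x B \<noteq> 0" "y B \<noteq> 0"
    and W: "fun_space.subspace W" "determined_on B W"
    and xW: "\<And>b. b \<in> B \<Longrightarrow> circ x (B - {b}) \<in> W"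
    and yW: "\<And>b. b \<in> B \<Longrightarrow> circ y (B - {b}) \<in> W"
  shows "y = fun_scale (y B / x B) x"
proof
  let ?c = "y B / x B"
  fix A
  show "y A = fun_scale ?c x A"
  proof (cases "A \<in> coord_sets n")
    case True
    show ?thesis
    proof (rule restricted_GP_unique[OF y(1) restricted_GP_scale[OF x(1)] B(1) _ B(3) _ True])
      show "y B = fun_scale ?c x B" using B by (simp add: fun_scale_apply)
      fix b assume b: "b \<in> B"
      have "circ y (B - {b}) - fun_scale ?c (circ x (B - {b})) = 0"
      proof (rule determined_onD[OF W(2)])
        show "circ y (B - {b}) - fun_scale ?c (circ x (B - {b})) \<in> W"
          by (intro fun_space.subspace_diff fun_space.subspace_scale W(1) xW yW b)
        fix c assume c: "c \<in> B"
        show "(circ y (B - {b}) - fun_scale ?c (circ x (B - {b}))) c = 0"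
          using circ_transversal_off_diag[OF b c, of x] circ_transversal_off_diag[OF b c, of y]
            circ_transversal_diag[OF b, of x] circ_transversal_diag[OF b, of y] B(2)
          by (cases "c = b") (simp_all add: fun_scale_apply)
      qed
      then show "circ y (B - {b}) = circ (fun_scale ?c x) (B - {b})"
        by (simp only: circ_scale right_minus_eq)
    qed
  next
    case False
    then show ?thesis using x(2) y(2) by (simp add: supported_on_def fun_scale_apply)
  qed
qed

section \<open>The parametrization and its image\<close>

lemma proj_point_scale:
  assumes "c \<noteq> 0"
  shows "proj_point (fun_scale c x) = proj_point x"
  using fun_space.span_image_scale[of "{x}" "\<lambda>_. c"] assms by (simp add: proj_point_def)

lemma proj_point_iff: "z \<in> proj_point x \<longleftrightarrow> (\<exists>c. z = fun_scale c x)"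
  by (auto simp: proj_point_def fun_space.span_singleton)

lemma row_space_subspace: "fun_space.subspace (row_space n \<Lambda>)"
  by (simp add: row_space_def)

lemma Phi_eq:
  fixes W :: "(nat \<Rightarrow> 'k::field) set"
  assumes W: "W \<in> Lag n" and \<Lambda>: "\<Lambda> \<in> matrices n" "row_space n \<Lambda> = W"
  shows "Phi n W = proj_point (minors n \<Lambda>)"
  unfolding Phi_def
proof (rule the_equality)
  show "\<exists>\<Lambda>'\<in>matrices n. row_space n \<Lambda>' = W \<and> proj_point (minors n \<Lambda>) = proj_point (minors n \<Lambda>')"
    using \<Lambda> by blast
  fix p assume "\<exists>\<Lambda>\<in>matrices n. row_space n \<Lambda> = W \<and> p = proj_point (minors n \<Lambda>)"
  then obtain \<Lambda>' where \<Lambda>': "\<Lambda>' \<in> matrices n" "row_space n \<Lambda>' = W" "p = proj_point (minors n \<Lambda>')" by blast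
  obtain B where B: "B \<in> transversals n" "determined_on B W"
    "\<And>\<Lambda>. row_space n \<Lambda> = W \<Longrightarrow> minors n \<Lambda> B \<noteq> 0"
    using Lag_minors_transversal[OF W] by blast
  note sub = transversal_remove_in_subtransversals[OF B(1)]
  have "minors n \<Lambda>' = fun_scale (minors n \<Lambda>' B / minors n \<Lambda> B) (minors n \<Lambda>)"
  proof (rule restricted_GP_proportional[OF minors_restricted_GP[OF \<Lambda>(1)] minors_supported
        minors_restricted_GP[OF \<Lambda>'(1)] minors_supported B(1) _ _ _ B(2)])
    show "fun_space.subspace W" using row_space_subspace[of n \<Lambda>] \<Lambda>(2) by simp
  qed (use B(3) \<Lambda> \<Lambda>' circ_minors(2)[OF \<Lambda>(1) sub] circ_minors(2)[OF \<Lambda>'(1) sub] in auto)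
  then show "p = proj_point (minors n \<Lambda>)"
    unfolding \<Lambda>'(3) using proj_point_scale[of "minors n \<Lambda>' B / minors n \<Lambda> B" "minors n \<Lambda>"] B(3) \<Lambda> \<Lambda>' by simp
qed

lemma supported_on_finite_dim:
  fixes I :: "'a set"
  assumes "finite I"
  shows "\<exists>F. finite F \<and> supported_on I \<subseteq> (fun_space.span F :: ('a \<Rightarrow> 'k::field) set)"
proof -
  let ?d = "\<lambda>i j. of_bool (j = i) :: 'k"
  have "supported_on I \<subseteq> fun_space.span (?d ` I)"
  proof
    fix f :: "'a \<Rightarrow> 'k" assume f: "f \<in> supported_on I"
    have "f = (\<Sum>i\<in>I. fun_scale (f i) (?d i))"
    proof
      fix j
      have "(\<Sum>i\<in>I. fun_scale (f i) (?d i)) j = (\<Sum>i\<in>I. if i = j then f i else 0)"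
        unfolding sum_fun_apply fun_scale_apply by (intro sum.cong) auto
      also have "\<dots> = f j" using f assms by (simp add: supported_on_def)
      finally show "f j = (\<Sum>i\<in>I. fun_scale (f i) (?d i)) j" by simp
    qed
    also have "\<dots> \<in> fun_space.span (?d ` I)"
      by (intro fun_space.span_sum fun_space.span_scale fun_space.span_base) auto
    finally show "f \<in> fun_space.span (?d ` I)" .
  qed
  then show ?thesis using assms by blast
qed

lemma Lag_row_space:
  fixes W :: "(nat \<Rightarrow> 'k::field) set"
  assumes W: "W \<in> Lag n"
  obtains \<Lambda> where "\<Lambda> \<in> matrices n" "row_space n \<Lambda> = W"
proof -
  have sub: "fun_space.subspace W" and supp: "W \<subseteq> supported_on (ground n)" and dim: "fun_space.dim W = n"
    using W by (auto simp: Lag_def isotropic_subspace_def)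
  obtain C where C: "C \<subseteq> W" "fun_space.independent C" "W \<subseteq> fun_space.span C" "card C = n"
    using fun_space.basis_exists[of W] dim by metis
  obtain F :: "(nat \<Rightarrow> 'k) set" where F: "finite F" "supported_on (ground n) \<subseteq> fun_space.span F"
    using supported_on_finite_dim[OF finite_ground] by blast
  \<comment> \<open>For \<open>n = 0\<close> the equation \<open>card C = n\<close> would also hold
    for an infinite \<open>C\<close>, so finiteness is taken from the ambient space.\<close>
  have "finite C" using fun_space.independent_span_bound[OF F(1) C(2)] C(1) supp F(2) by blast
  then obtain \<Lambda> where bij: "bij_betw \<Lambda> {1..n} C"
    using finite_same_card_bij[of "{1..n}" C] C(4) by auto
  have img: "\<Lambda> ` {1..n} = C" using bij by (simp add: bij_betw_def)
  show ?thesis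
  proof
    show "\<Lambda> \<in> matrices n" using img C(1) supp by (auto simp: matrices_def)
    show "row_space n \<Lambda> = W"
      unfolding row_space_def img using C sub by (intro fun_space.span_subspace)
  qed
qed

lemma Lag_minors:
  fixes W :: "(nat \<Rightarrow> 'k::field) set"
  assumes W: "W \<in> Lag n" and \<Lambda>: "\<Lambda> \<in> matrices n" "row_space n \<Lambda> = W"
  shows "minors n \<Lambda> \<in> coord_space n - {0}"
proof -
  have "isotropic_subspace n (row_space n \<Lambda>)" using W \<Lambda> by (auto simp: Lag_def)
  moreover obtain B where "minors n \<Lambda> B \<noteq> 0" using Lag_minors_transversal[OF W] \<Lambda>(2) by metis
  ultimately show ?thesis using isotropic_minors_in_coord_space[OF \<Lambda>(1)] by auto
qed

text \<open>\<open>W\<close> can be recovered from its point, being spanned by the vectors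
  \<open>circ ?y (B - {b})\<close>. As the two coordinate vectors are proportional, the same vectors
  span \<open>W'\<close>.\<close>

lemma Phi_inj: "inj_on (Phi n) (Lag n :: (nat \<Rightarrow> 'k::field) set set)"
proof (rule inj_onI)
  fix W W' :: "(nat \<Rightarrow> 'k) set"
  assume W: "W \<in> Lag n" and W': "W' \<in> Lag n" and eq: "Phi n W = Phi n W'"
  obtain \<Lambda> where \<Lambda>: "\<Lambda> \<in> matrices n" "row_space n \<Lambda> = W" using Lag_row_space[OF W] .
  obtain \<Lambda>' where \<Lambda>': "\<Lambda>' \<in> matrices n" "row_space n \<Lambda>' = W'" using Lag_row_space[OF W'] .
  let ?y = "minors n \<Lambda>" and ?y' = "minors n \<Lambda>'"
  have "?y \<in> proj_point ?y'"
    using eq Phi_eq[OF W \<Lambda>] Phi_eq[OF W' \<Lambda>'] proj_point_iff[of ?y ?y] by (metis fun_space.scale_one)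
  then obtain c where c: "?y = fun_scale c ?y'" by (auto simp: proj_point_iff)
  obtain B where B: "B \<in> transversals n" "determined_on B W" "?y B \<noteq> 0"
    using Lag_minors_transversal[OF W] \<Lambda>(2) by metis
  have B': "finite B" "card B = n" "B \<in> coord_sets n" using transversal_finite[OF B(1)] by auto
  have "full_minors n \<Lambda>' B \<noteq> 0"
    using B(3) minors_eq[OF B'(3), of \<Lambda>'] unfolding c by (auto simp: fun_scale_apply)
  then have det': "determined_on B W'" using row_space_determined_on[OF B'(1,2)] \<Lambda>'(2) by blast
  let ?v = "\<lambda>b. circ ?y (B - {b})"
  note sub = transversal_remove_in_subtransversals[OF B(1)]
  note frame = circ_dual_frame[OF B'(1), of ?y, OF B(3)]
  have "fun_space.span (?v ` B) = W"
  proof (rule dual_frame_span_eq[OF frame])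
    show "fun_space.subspace W" using row_space_subspace[of n \<Lambda>] \<Lambda>(2) by simp
    show "?v b \<in> W" if "b \<in> B" for b using circ_minors(2)[OF \<Lambda>(1) sub[OF that]] \<Lambda>(2) by simp
  qed (rule B(2))
  moreover have "fun_space.span (?v ` B) = W'"
  proof (rule dual_frame_span_eq[OF frame])
    show s: "fun_space.subspace W'" using row_space_subspace[of n \<Lambda>'] \<Lambda>'(2) by simp
    show "?v b \<in> W'" if "b \<in> B" for b
      using circ_minors(2)[OF \<Lambda>'(1) sub[OF that]] \<Lambda>'(2) fun_space.subspace_scale[OF s]
      unfolding c circ_scale by simp
  qed (rule det')
  ultimately show "W = W'" by simp
qed

lemma GP_point_in_image:
  fixes x :: "nat set \<Rightarrow> 'k::field"
  assumes gp: "restricted_GP n x" and x: "x \<in> coord_space n" "x \<noteq> 0"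
  shows "\<exists>W \<in> Lag n. Phi n W = proj_point x"
proof -
  have xs: "x \<in> supported_on (coord_sets n)" using x(1) by (simp add: coord_space_iff)
  obtain B where B: "B \<in> transversals n" "x B \<noteq> 0"
    using restricted_GP_transversal_nonzero[OF gp x] .
  have B': "finite B" "card B = n" "B \<in> coord_sets n" using transversal_finite[OF B(1)] by auto
  have Bg: "B \<subseteq> ground n" "\<forall>e\<in>B. star n e \<notin> B" using B(1) by (auto simp: transversals_iff)
  define v where "v b = circ x (B - {b})" for b
  let ?W = "fun_space.span (v ` B)"
  have frame: "dual_frame B v"
    unfolding v_def by (rule circ_dual_frame[where x = x, OF B'(1) B(2)])
  have Wsup: "?W \<subseteq> supported_on (ground n)"
    by (intro fun_space.span_minimal subspace_supported_on) (auto simp: v_def intro: circ_supported[OF xs])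
  \<comment> \<open>For \<open>b \<noteq> c\<close>, the set \<open>?U\<close> misses the pairs of
    \<open>b\<close> and \<open>c\<close>, and the last factor in \<open>misses_symp_form\<close>
    vanishes by the linear relation for \<open>?U\<close>.\<close>
  have orth: "symp_form n (v b) (v c) = 0" if bc: "b \<in> B" "c \<in> B" for b c
  proof (cases "b = c")
    case True
    then show ?thesis by (simp add: symp_form_self)
  next
    case False
    let ?U = "B - {b, c}" and ?i = "index_of n b" and ?j = "index_of n c"
    have g: "b \<in> ground n" "c \<in> ground n" using bc Bg by auto
    have "card {b, c} \<le> card B" using bc B' by (intro card_mono) auto
    moreover have "card ?U = card B - card {b, c}" using bc B' by (intro card_Diff_subset) auto
    ultimately have "card ?U + 2 = n" using B' False by simp
    moreover have "no_skew_pair n ?U" using B(1) unfolding transversals_def no_skew_pair_def by blast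
    moreover have "?i \<noteq> ?j" using index_of_eq_iff[OF g] False bc Bg by auto
    moreover have "?U \<subseteq> ground n" using Bg by blast
    moreover have "{b, star n b} \<inter> ?U = {}" "{c, star n c} \<inter> ?U = {}" using Bg(2) bc by auto
    moreover note index_of_in[OF g(1)] index_of_in[OF g(2)]
    ultimately have m: "misses n ?U ?j ?i"
      unfolding misses_def pair_of_index_of[OF g(1)] pair_of_index_of[OF g(2)] by metis
    have "c \<in> {?j, star n ?j}" "b \<in> {?i, star n ?i}"
      unfolding pair_of_index_of[OF g(1)] pair_of_index_of[OF g(2)] by simp_all
    from misses_symp_form[OF m this, of x] obtain \<sigma> :: 'k where
      "symp_form n (circ x (insert c ?U)) (circ x (insert b ?U)) = \<sigma> * x (?U \<union> {c, b}) *
       ((-1) ^ ?j * x (?U \<union> {?j, star n ?j}) - (-1) ^ ?i * x (?U \<union> {?i, star n ?i}))" by blast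
    moreover have "insert c ?U = B - {b}" "insert b ?U = B - {c}" using bc False by auto
    moreover have "(-1) ^ ?j * x (?U \<union> {?j, star n ?j}) = (-1) ^ ?i * x (?U \<union> {?i, star n ?i})"
      using x(1) m unfolding coord_space_iff by blast
    ultimately show ?thesis by (simp add: v_def)
  qed
  have iso: "isotropic_subspace n ?W"
    unfolding isotropic_subspace_def
  proof (intro conjI ballI Wsup fun_space.subspace_span)
    have "symp_form n Y Z = 0" if "Y \<in> v ` B" "Z \<in> v ` B" for Y Z using orth that by blast
    moreover fix X Y assume "X \<in> ?W" "Y \<in> ?W"
    ultimately show "symp_form n X Y = 0" by (rule symp_form_span)
  qed
  have dim: "fun_space.dim ?W = n" using dual_frame_dim[OF frame] B'(2) by simp
  have det: "determined_on B ?W" by (rule dual_frame_determined[OF frame])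
  have max: "W' = ?W" if W': "isotropic_subspace n W'" "?W \<subseteq> W'" for W'
  proof
    have s: "fun_space.subspace W'" "W' \<subseteq> supported_on (ground n)"
      "\<And>X Y. X \<in> W' \<Longrightarrow> Y \<in> W' \<Longrightarrow> symp_form n X Y = 0" using W'(1) by (auto simp: isotropic_subspace_def)
    have vW: "v b \<in> W'" if "b \<in> B" for b using W'(2) fun_space.span_base[of "v b" "v ` B"] that by blast
    show "W' \<subseteq> ?W"
    proof
      fix w assume "w \<in> W'"
      with dual_frame_remainder[OF frame s(1) vW] obtain u
        where u: "u \<in> W'" "\<And>b. b \<in> B \<Longrightarrow> u b = 0" "w - u \<in> ?W" by blast
      \<comment> \<open>\<open>u\<close> vanishes on \<open>B\<close> and \<open>v b\<close> on
        \<open>B - {b}\<close>. Every pair other than that of \<open>b\<close> has an element in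
        \<open>B\<close>, where both vanish, so the form reduces to
        \<open>u (star n b) * v b b\<close> up to sign.\<close>
      have us: "u (star n b) = 0" if b: "b \<in> B" for b
      proof -
        have g: "b \<in> ground n" using b Bg by auto
        have "symp_form n u (v b) = symp_term n u (v b) (index_of n b)"
        proof (rule symp_form_one)
          show "index_of n b \<in> {1..n}" by (rule index_of_in[OF g])
          fix k assume k: "k \<in> {1..n}" "k \<noteq> index_of n b"
          then have kg: "k \<in> ground n" "star n k \<in> ground n" by simp_all
          have "k \<noteq> b" "star n k \<noteq> b" using k index_of_star[OF kg(1)] by auto
          moreover have "k \<in> B \<or> star n k \<in> B" using transversal_star_iff[OF B(1) kg(1)] by blast
          ultimately show "symp_term n u (v b) k = 0"
            using u(2) dual_frame_off_diag[OF frame b] by (auto simp: symp_term_def)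
        qed
        also have "\<dots> = (if b \<le> n then 1 else -1) * (- u (star n b) * v b b)"
          unfolding symp_term_index_of[OF g] using u(2)[OF b] by simp
        finally show ?thesis using s(3)[OF u(1) vW[OF b]] dual_frame_diag[OF frame b] by (auto split: if_splits)
      qed
      have "u = 0"
      proof
        fix e
        consider "e \<notin> ground n" | "e \<in> B" | "e \<in> ground n" "star n e \<in> B"
          using transversal_star_iff[OF B(1)] by blast
        then show "u e = 0 e"
        proof cases
          case 1
          then show ?thesis using u(1) s(2) by (auto simp: supported_on_def)
        next
          case 3
          then show ?thesis using us[of "star n e"] by simp
        qed (use u(2) in simp)
      qed
      then show "w \<in> ?W" using u(3) by simp
    qed
  qed (rule W'(2))
  have W: "?W \<in> Lag n" using iso dim max by (auto simp: Lag_def)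
  obtain \<Lambda> where \<Lambda>: "\<Lambda> \<in> matrices n" "row_space n \<Lambda> = ?W" using Lag_row_space[OF W] .
  let ?y = "minors n \<Lambda>"
  have yB: "?y B \<noteq> 0"
    using full_minor_nonzero[OF B'(1,2), of \<Lambda>] \<Lambda>(2) det dim minors_eq[OF B'(3), of \<Lambda>] by simp
  note sub = transversal_remove_in_subtransversals[OF B(1)]
  have "?y = fun_scale (?y B / x B) x"
  proof (rule restricted_GP_proportional[OF gp xs minors_restricted_GP[OF \<Lambda>(1)] minors_supported
        B yB fun_space.subspace_span det])
    show "circ x (B - {b}) \<in> ?W" if "b \<in> B" for b
      using that by (intro fun_space.span_base) (auto simp: v_def)
    show "circ ?y (B - {b}) \<in> ?W" if "b \<in> B" for b
      using circ_minors(2)[OF \<Lambda>(1) sub[OF that]] \<Lambda>(2) by simp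
  qed
  then have "proj_point ?y = proj_point x"
    using proj_point_scale[of "?y B / x B" x] B(2) yB by simp
  then show ?thesis using W Phi_eq[OF W \<Lambda>] by auto
qed

lemma Phi_image:
  "Phi n ` (Lag n :: (nat \<Rightarrow> 'k::field) set set) =
      {p \<in> proj_space (coord_space n). \<forall>x\<in>p. restricted_GP n x}"
proof (intro equalityI subsetI)
  fix p assume "p \<in> Phi n ` (Lag n :: (nat \<Rightarrow> 'k) set set)"
  then obtain W :: "(nat \<Rightarrow> 'k) set" where W: "W \<in> Lag n" "p = Phi n W" by blast
  obtain \<Lambda> where \<Lambda>: "\<Lambda> \<in> matrices n" "row_space n \<Lambda> = W" using Lag_row_space[OF W(1)] .
  have p: "p = proj_point (minors n \<Lambda>)" using Phi_eq[OF W(1) \<Lambda>] W(2) by simp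
  have "restricted_GP n x" if "x \<in> p" for x
    using that minors_restricted_GP[OF \<Lambda>(1)] restricted_GP_scale unfolding p proj_point_iff by blast
  moreover have "p \<in> proj_space (coord_space n)"
    unfolding p proj_space_def using Lag_minors[OF W(1) \<Lambda>] by blast
  ultimately show "p \<in> {p \<in> proj_space (coord_space n). \<forall>x\<in>p. restricted_GP n x}" by blast
next
  fix p :: "(nat set \<Rightarrow> 'k) set"
  assume "p \<in> {p \<in> proj_space (coord_space n). \<forall>x\<in>p. restricted_GP n x}"
  then obtain x where x: "x \<in> coord_space n" "x \<noteq> 0" "p = proj_point x" "\<forall>x\<in>p. restricted_GP n x"
    by (auto simp: proj_space_def)
  have "x \<in> p" unfolding x(3) proj_point_iff by (metis fun_space.scale_one)
  then show "p \<in> Phi n ` Lag n" using GP_point_in_image[OF _ x(1,2)] x(3,4) by auto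
qed

section \<open>The dimension of the coordinate space\<close>

definition partial_transversals :: "nat \<Rightarrow> nat \<Rightarrow> nat set set" where
  "partial_transversals n m = {U. U \<subseteq> ground n \<and> card U = m \<and> no_skew_pair n U}"

lemma finite_partial_transversals: "finite (partial_transversals n m)"
  by (rule finite_subset[of _ "Pow (ground n)"]) (auto simp: partial_transversals_def)

text \<open>
  A partial transversal is encoded by the set \<open>D\<close> of the indices it meets together with the
  set \<open>P \<subseteq> D\<close> of the indices at which it contains the unstarred element.
\<close>

lemma card_partial_transversals: "card (partial_transversals n m) = (n choose m) * 2 ^ m"
proof -
  let ?C = "SIGMA D:{D. D \<subseteq> {1..n} \<and> card D = m}. Pow D"
  let ?f = "\<lambda>(D, P). P \<union> star n ` (D - P)"
  let ?g = "\<lambda>U. (index_of n ` U, U \<inter> {1..n})"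
  have fg: "?f p \<in> partial_transversals n m \<and> ?g (?f p) = p" if pC: "p \<in> ?C" for p
  proof -
    obtain D P where p: "p = (D, P)" and D: "D \<subseteq> {1..n}" "card D = m" and P: "P \<subseteq> D"
      using pC by auto
    let ?U = "P \<union> star n ` (D - P)"
    have bnd: "1 \<le> k \<and> k \<le> n" if "k \<in> D" for k using that D(1) by auto
    have bndP: "1 \<le> k \<and> k \<le> n" if "k \<in> P" for k using bnd that P by auto
    have U: "?U \<subseteq> ground n" by (auto simp: ground_def star_def dest!: bnd bndP)
    have low: "?U \<inter> {1..n} = P" using bnd bndP by (force simp: star_def)
    have st: "star n k = n + k" "index_of n (n + k) = k" "index_of n k = k" if "k \<in> D" for k
      using bnd[OF that] by (auto simp: star_def index_of_def)
    have "index_of n ` ?U = index_of n ` P \<union> (\<lambda>k. index_of n (star n k)) ` (D - P)"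
      by (simp add: image_Un image_image)
    also have "\<dots> = P \<union> (D - P)"
    proof -
      have "index_of n ` P = P" using st(3) P by (force simp: image_iff)
      moreover have "(\<lambda>k. index_of n (star n k)) ` (D - P) = D - P" using st by (force simp: image_iff)
      ultimately show ?thesis by simp
    qed
    also have "\<dots> = D" using P by auto
    finally have ix: "index_of n ` ?U = D" .
    have ns: "no_skew_pair n ?U"
      unfolding no_skew_pair_iff[OF U]
    proof (intro ballI notI)
      fix e assume e: "e \<in> ?U" "star n e \<in> ?U"
      from e(1) show False
      proof
        assume eP: "e \<in> P"
        then have eD: "e \<in> D" using P by blast
        from e(2) show False
        proof
          assume "star n e \<in> P"
          then show False using bndP[of "n + e"] bnd[OF eD] st(1)[OF eD] by simp
        next
          assume "star n e \<in> star n ` (D - P)"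
          then obtain l where "l \<in> D" "l \<notin> P" "star n e = star n l" by blast
          then show False using st(1)[of l] st(1)[OF eD] eP by simp
        qed
      next
        assume "e \<in> star n ` (D - P)"
        then obtain l where l: "l \<in> D" "l \<notin> P" "e = n + l" using st(1) by auto
        have "star n e = l" using bnd[OF l(1)] l(3) by (simp add: star_def)
        with e(2) l(2) have "l \<in> star n ` (D - P)" by simp
        then obtain l' where "l' \<in> D" "l = n + l'" using st(1) by auto
        then show False using bnd[OF l(1)] bnd[of l'] by simp
      qed
    qed
    have "card ?U = m" using card_image[OF inj_on_index_of[OF U ns]] ix D by simp
    then show ?thesis unfolding p using U ns ix low by (simp add: partial_transversals_def)
  qed
  have gf: "?g U \<in> ?C \<and> ?f (?g U) = U" if "U \<in> partial_transversals n m" for U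
  proof -
    have U: "U \<subseteq> ground n" "card U = m" "no_skew_pair n U" using that by (auto simp: partial_transversals_def)
    let ?D = "index_of n ` U" and ?P = "U \<inter> {1..n}"
    have "?D \<subseteq> {1..n}" using U(1) index_of_in by blast
    moreover have "card ?D = m" using card_image[OF inj_on_index_of[OF U(1,3)]] U(2) by simp
    moreover have "?P \<subseteq> ?D"
    proof
      fix k assume "k \<in> ?P"
      then show "k \<in> ?D" using index_of_index[of k n] by (intro image_eqI[of _ _ k]) auto
    qed
    moreover have "?P \<union> star n ` (?D - ?P) = U"
    proof (intro equalityI subsetI)
      fix e assume "e \<in> ?P \<union> star n ` (?D - ?P)"
      then show "e \<in> U"
      proof
        assume "e \<in> star n ` (?D - ?P)"
        then obtain u where u: "u \<in> U" "index_of n u \<notin> ?P" "e = star n (index_of n u)" by blast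
        have "u \<in> ground n" using u U by auto
        then have "e \<in> {u, star n u}" "index_of n u \<in> {u, star n u}" "index_of n u \<in> {1..n}"
          using pair_of_index_of[of u n] index_of_in[of u n] u(3) by blast+
        then show "e \<in> U" using u \<open>u \<in> ground n\<close> by auto
      qed simp
    next
      fix e assume e: "e \<in> U"
      then have "e \<in> ground n" using U by auto
      then show "e \<in> ?P \<union> star n ` (?D - ?P)"
      proof (cases rule: ground_cases)
        case (1 i)
        then show ?thesis using e by simp
      next
        case (2 i)
        then have i: "index_of n e = i" "star n i = e" by (auto simp: index_of_def star_def)
        moreover have "i \<notin> U" using U(3) e i(2) no_skew_pair_iff[OF U(1)] by metis
        ultimately show ?thesis using e by force
      qed
    qed
    ultimately show ?thesis by simp
  qed
  have "bij_betw ?g (partial_transversals n m) ?C"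
  proof (rule bij_betw_byWitness[where f' = ?f])
    show "\<forall>U\<in>partial_transversals n m. ?f (?g U) = U" by (rule ballI) (rule conjunct2[OF gf])
    show "\<forall>p\<in>?C. ?g (?f p) = p" by (rule ballI) (rule conjunct2[OF fg])
    show "?g ` partial_transversals n m \<subseteq> ?C" by (rule image_subsetI) (rule conjunct1[OF gf])
    show "?f ` ?C \<subseteq> partial_transversals n m" by (rule image_subsetI) (rule conjunct1[OF fg])
  qed
  then have "card (partial_transversals n m) = card ?C" by (rule bij_betw_same_card)
  also have "\<dots> = (\<Sum>D\<in>{D. D \<subseteq> {1..n} \<and> card D = m}. card (Pow D))"
    by (rule card_SigmaI) (auto intro: finite_subset[OF _ finite_Pow_iff[THEN iffD2]] dest: finite_subset)
  also have "\<dots> = (\<Sum>D\<in>{D. D \<subseteq> {1..n} \<and> card D = m}. 2 ^ m)"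
    by (rule sum.cong) (auto simp: card_Pow dest: finite_subset)
  also have "\<dots> = (n choose m) * 2 ^ m" using n_subsets[of "{1..n}" m] by simp
  finally show ?thesis .
qed

text \<open>Labels of the coordinates after identification: the transversals, and the sets
  \<open>U\<close> of size \<open>n - 2\<close>, each standing for two almost-transversals. Writing
  \<open>card U + 2 = n\<close> avoids truncated subtraction for \<open>n < 2\<close>.\<close>

definition coord_index :: "nat \<Rightarrow> nat set set" where
  "coord_index n = {U. U \<subseteq> ground n \<and> no_skew_pair n U \<and> (card U = n \<or> card U + 2 = n)}"

text \<open>The \<open>2 ^ n\<close> transversals account for the \<open>4\<close>, the sets of size
  \<open>n - 2\<close> for the binomial coefficient. For \<open>n < 2\<close> the latter do not
  exist and the exponent is negative, hence the real power.\<close>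

lemma card_coord_index:
  "real (card (coord_index n)) = 2 powi (int n - 2) * (4 + real (n choose 2))"
proof (cases "n < 2")
  case True
  then have "coord_index n = partial_transversals n n"
    by (auto simp: coord_index_def partial_transversals_def)
  then have "card (coord_index n) = 2 ^ n" by (simp add: card_partial_transversals)
  moreover have "n = 0 \<or> n = 1" using True by auto
  ultimately show ?thesis by (auto simp: power_int_def binomial_eq_0 power2_eq_square)
next
  case False
  then obtain k where k: "n = k + 2" by (metis add.commute le_Suc_ex not_less)
  have "coord_index n = partial_transversals n n \<union> partial_transversals n k"
    by (auto simp: coord_index_def partial_transversals_def k)
  moreover have "partial_transversals n n \<inter> partial_transversals n k = {}"
    by (auto simp: partial_transversals_def k)
  ultimately have "card (coord_index n) = 2 ^ n + (n choose k) * 2 ^ k"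
    by (simp add: card_Un_disjoint finite_partial_transversals card_partial_transversals)
  moreover have "n choose k = n choose 2" using binomial_symmetric[of k n] k by simp
  moreover have "(2::real) powi (int n - 2) = 2 ^ k" using k by (simp add: power_int_def)
  ultimately show ?thesis using k by (simp add: algebra_simps power_add)
qed

text \<open>Empty at a transversal and a singleton at an almost-transversal, so that its sum is the
  exponent of the sign in both cases.\<close>

definition skew_indices :: "nat \<Rightarrow> nat set \<Rightarrow> nat set" where
  "skew_indices n A = {i \<in> {1..n}. i \<in> A \<and> star n i \<in> A}"

text \<open>
  Two coordinates are identified precisely when their index sets have the same core; the sign
  below is the \<open>(-1) ^ i\<close> of the identification, and \<open>1\<close> at transversals.
\<close>

definition core :: "nat \<Rightarrow> nat set \<Rightarrow> nat set" where
  "core n A = {e \<in> A. star n e \<notin> A}"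

abbreviation coord_sign :: "nat \<Rightarrow> nat set \<Rightarrow> 'k::field" where
  "coord_sign n A \<equiv> (-1) ^ \<Sum> (skew_indices n A)"

lemma transversal_core: "B \<in> transversals n \<Longrightarrow> core n B = B"
  by (auto simp: core_def transversals_iff)

context
  fixes n U i j
  assumes m: "misses n U i j"
begin

lemma misses_star_in_iff:
  assumes e: "e \<in> U \<union> {i, star n i}"
  shows "star n e \<in> U \<union> {i, star n i} \<longleftrightarrow> e \<notin> U"
proof -
  have "i \<in> ground n" and U: "U \<subseteq> ground n" "no_skew_pair n U" "i \<notin> U" "star n i \<notin> U"
    using m unfolding misses_def by auto
  show ?thesis
  proof (cases "e \<in> U")
    case True
    then have e: "star n (star n e) = e" "star n e \<notin> U"
      using U(1,2) no_skew_pair_iff[OF U(1)] by (blast intro: star_star)+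
    have "star n e \<noteq> i" using e(1) U(4) True by metis
    moreover have "star n e \<noteq> star n i" using e(1) star_star[OF \<open>i \<in> ground n\<close>] U(3) True by metis
    ultimately show ?thesis using True e(2) by simp
  next
    case False
    then show ?thesis using e \<open>i \<in> ground n\<close> by auto
  qed
qed

lemma misses_core: "core n (U \<union> {i, star n i}) = U"
  using misses_star_in_iff m unfolding core_def misses_def by blast

lemma misses_skew_indices: "skew_indices n (U \<union> {i, star n i}) = {i}"
proof -
  have i: "i \<in> {1..n}" "i \<notin> U" using m unfolding misses_def by auto
  have "k \<in> skew_indices n (U \<union> {i, star n i}) \<longleftrightarrow> k = i" for k
  proof
    assume "k \<in> skew_indices n (U \<union> {i, star n i})"
    then have k: "k \<in> {1..n}" "k \<in> U \<union> {i, star n i}" "star n k \<in> U \<union> {i, star n i}"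
      by (auto simp: skew_indices_def)
    then have "k \<notin> U" using misses_star_in_iff[OF k(2)] by simp
    then show "k = i" using k i by (auto simp: star_def)
  qed (use i in \<open>auto simp: skew_indices_def\<close>)
  then show ?thesis by auto
qed

end

lemma core_in_coord_index:
  assumes "A \<in> coord_sets n"
  shows "core n A \<in> coord_index n"
proof (cases "A \<in> transversals n")
  case True
  then show ?thesis using transversal_core[OF True] by (auto simp: coord_index_def transversals_def)
next
  case False
  then obtain U i j where m: "misses n U i j" and A: "A = U \<union> {i, star n i}"
    using assms almost_transversalE by blast
  then show ?thesis using misses_core[OF m] unfolding A by (simp add: misses_def coord_index_def)
qed

lemma coord_index_core:
  assumes U: "U \<in> coord_index n"
  shows "\<exists>A\<in>coord_sets n. core n A = U"
proof (cases "card U = n")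
  case True
  then have "U \<in> transversals n" using U by (auto simp: coord_index_def transversals_def)
  then show ?thesis using transversal_core by blast
next
  case False
  then have U': "U \<subseteq> ground n" "no_skew_pair n U" "card U + 2 = n" using U by (auto simp: coord_index_def)
  have fU: "finite U" using U'(1) finite_subset[OF _ finite_ground] by blast
  have "index_of n ` U \<subseteq> {1..n}" using U'(1) index_of_in by blast
  then have "card ({1..n} - index_of n ` U) = 2"
    using card_image[OF inj_on_index_of[OF U'(1,2)]] U'(3) fU by (simp add: card_Diff_subset)
  then obtain i j where ij: "{1..n} - index_of n ` U = {i, j}" "i \<noteq> j" by (auto simp: card_2_iff)
  have miss: "k \<in> {1..n} \<and> {k, star n k} \<inter> U = {}" if "k \<in> {i, j}" for k
  proof -
    have k: "k \<in> {1..n}" "k \<notin> index_of n ` U" using that ij(1) by blast+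
    then have "index_of n k = k" "index_of n (star n k) = k" by simp_all
    then show ?thesis using k by (auto simp: image_iff)
  qed
  have m: "misses n U i j" unfolding misses_def using U' ij(2) miss[of i] miss[of j] by blast
  then show ?thesis using misses_core[OF m] misses_almost_transversal[OF m] by blast
qed

text \<open>The core of a transversal has \<open>n\<close> elements and that of an
  almost-transversal \<open>n - 2\<close>, so the kinds do not mix. Two different
  almost-transversals with core \<open>U\<close> are related by a single instance of the
  identification, since \<open>U\<close> misses both their indices.\<close>

lemma coord_space_iff_core:
  "x \<in> coord_space n \<longleftrightarrow> x \<in> supported_on (coord_sets n) \<and>
    (\<forall>A\<in>coord_sets n. \<forall>A'\<in>coord_sets n. core n A = core n A' \<longrightarrow>
      coord_sign n A * x A = coord_sign n A' * x A')"
proof (intro iffI conjI)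
  assume x: "x \<in> coord_space n"
  then show "x \<in> supported_on (coord_sets n)" by (simp add: coord_space_iff)
  show "\<forall>A\<in>coord_sets n. \<forall>A'\<in>coord_sets n. core n A = core n A' \<longrightarrow>
      coord_sign n A * x A = coord_sign n A' * x A'"
  proof (intro ballI impI)
    fix A A' assume A: "A \<in> coord_sets n" "A' \<in> coord_sets n" and eq: "core n A = core n A'"
    show "coord_sign n A * x A = coord_sign n A' * x A'"
    proof (cases "A \<in> transversals n \<or> A' \<in> transversals n")
      case True
      have card: "card B = n" if "B \<in> transversals n" for B using that by (auto simp: transversals_def)
      have small: "card (core n B) + 2 = n" if "B \<in> almost_transversals n" for B
        using that by (rule almost_transversalE) (use misses_core in \<open>auto simp: misses_def\<close>)
      have "A \<in> transversals n" "A' \<in> transversals n"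
        using True A eq small[of A] small[of A'] card transversal_core by fastforce+
      then show ?thesis using eq transversal_core by metis
    next
      case False
      then obtain U i j U' i' j' where
        m: "misses n U i j" "A = U \<union> {i, star n i}" and m': "misses n U' i' j'" "A' = U' \<union> {i', star n i'}"
        using A by (metis UnE almost_transversalE)
      then have "U' = U" using eq misses_core by metis
      show ?thesis
      proof (cases "i = i'")
        case True
        then show ?thesis using \<open>U' = U\<close> m m' by simp
      next
        case False
        then have "misses n U i i'" using m(1) m'(1) unfolding \<open>U' = U\<close> misses_def by blast
        then have "(-1) ^ i * x A = (-1) ^ i' * x A'"
          using x m(2) m'(2) \<open>U' = U\<close> unfolding coord_space_iff by blast
        then show ?thesis
          using misses_skew_indices[OF m(1)] misses_skew_indices[OF m'(1)] m(2) m'(2) by simp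
      qed
    qed
  qed
next
  assume x: "x \<in> supported_on (coord_sets n) \<and>
    (\<forall>A\<in>coord_sets n. \<forall>A'\<in>coord_sets n. core n A = core n A' \<longrightarrow>
      coord_sign n A * x A = coord_sign n A' * x A')"
  have "(-1) ^ i * x (U \<union> {i, star n i}) = (-1) ^ j * x (U \<union> {j, star n j})" if m: "misses n U i j" for U i j
  proof -
    let ?A = "U \<union> {i, star n i}" and ?A' = "U \<union> {j, star n j}"
    note m' = misses_sym[OF m]
    have "coord_sign n ?A * x ?A = coord_sign n ?A' * x ?A'"
      using x misses_almost_transversal[OF m] misses_almost_transversal[OF m']
        misses_core[OF m] misses_core[OF m'] by blast
    then show ?thesis unfolding misses_skew_indices[OF m] misses_skew_indices[OF m'] by simp
  qed
  then show "x \<in> coord_space n" using x unfolding coord_space_iff by blast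
qed

text \<open>Each core contributes one vector, supported on the sets with that core and having their
  signs as entries. At the representatives \<open>pt U\<close> these vectors form a dual frame, and
  a coordinate is determined by the one at its representative.\<close>

lemma dim_coord_space:
  "fun_space.dim (coord_space n :: (nat set \<Rightarrow> 'k::field) set) = card (coord_index n)"
proof -
  define pt where "pt = inv_into (coord_sets n) (core n)"
  let ?R = "pt ` coord_index n"
  define v :: "nat set \<Rightarrow> nat set \<Rightarrow> 'k" where
    "v b A = (if A \<in> coord_sets n \<and> core n A = core n b then coord_sign n A else 0)" for b A
  have pt: "pt U \<in> coord_sets n" "core n (pt U) = U" if "U \<in> coord_index n" for U
  proof -
    have "U \<in> core n ` coord_sets n" using coord_index_core[OF that] by auto
    then show "pt U \<in> coord_sets n" "core n (pt U) = U"
      unfolding pt_def by (rule inv_into_into, rule f_inv_into_f)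
  qed
  have fin: "finite (coord_index n)"
    by (rule finite_subset[of _ "Pow (ground n)"]) (auto simp: coord_index_def)
  have sub: "fun_space.subspace (coord_space n :: (nat set \<Rightarrow> 'k) set)"
  proof (rule fun_space.subspaceI)
    show "0 \<in> coord_space n" by (simp add: coord_space_iff_core supported_on_def)
    fix x y :: "nat set \<Rightarrow> 'k" and c :: 'k
    assume x: "x \<in> coord_space n"
    then show "fun_scale c x \<in> coord_space n"
      unfolding coord_space_iff by (simp add: supported_on_def fun_scale_apply mult.left_commute[of _ c])
    assume "y \<in> coord_space n"
    with x show "x + y \<in> coord_space n"
      unfolding coord_space_iff by (simp add: supported_on_def distrib_left)
  qed
  have frame: "dual_frame ?R v"
    using fin pt by (auto simp: dual_frame_def v_def)
  \<comment> \<open>On the class of \<open>b\<close> both sides of a relation are the square of a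
    sign, hence \<open>1\<close>; off it both are \<open>0\<close>.\<close>
  have vin: "v b \<in> coord_space n" for b
    unfolding coord_space_iff_core by (auto simp: supported_on_def v_def simp flip: power_mult_distrib)
  have "determined_on ?R (coord_space n :: (nat set \<Rightarrow> 'k) set)"
    unfolding determined_on_def
  proof (intro ballI impI)
    fix x :: "nat set \<Rightarrow> 'k" assume x: "x \<in> coord_space n" "\<forall>b\<in>?R. x b = 0"
    show "x = 0"
    proof
      fix A
      show "x A = 0 A"
      proof (cases "A \<in> coord_sets n")
        case True
        let ?b = "pt (core n A)"
        have c: "core n A \<in> coord_index n" by (rule core_in_coord_index[OF True])
        have "coord_sign n A * x A = coord_sign n ?b * x ?b"
          using x(1) True pt[OF c] unfolding coord_space_iff_core by metis
        then show ?thesis using x(2) c by simp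
      next
        case False
        then show ?thesis using x(1) by (simp add: coord_space_iff supported_on_def)
      qed
    qed
  qed
  from dual_frame_span_eq[OF frame sub vin this] dual_frame_dim[OF frame]
  have "fun_space.dim (coord_space n :: (nat set \<Rightarrow> 'k) set) = card ?R" by simp
  also have "\<dots> = card (coord_index n)"
    using pt(2) by (intro card_image inj_on_inverseI[of _ "core n"])
  finally show ?thesis .
qed

theorem theorem1p1:
  fixes n :: nat
  shows "real_of_int (proj_dim (coord_space n :: (nat set \<Rightarrow> 'k::field) set)) =
      2 powi (int n - 2) * (4 + real (n choose 2)) - 1 \<and>
    (\<forall>W \<in> (Lag n :: (nat \<Rightarrow> 'k) set set).
       (\<exists>\<Lambda>\<in>matrices n. row_space n \<Lambda> = W) \<and>
       (\<forall>\<Lambda>\<in>matrices n. row_space n \<Lambda> = W \<longrightarrow>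
          minors n \<Lambda> \<in> coord_space n - {0} \<and> Phi n W = proj_point (minors n \<Lambda>))) \<and>
    inj_on (Phi n) (Lag n :: (nat \<Rightarrow> 'k) set set) \<and>
    Phi n ` (Lag n :: (nat \<Rightarrow> 'k) set set) =
      {p \<in> proj_space (coord_space n). \<forall>x\<in>p. restricted_GP n x}"
proof (intro conjI ballI impI)
  show "real_of_int (proj_dim (coord_space n :: (nat set \<Rightarrow> 'k) set)) =
      2 powi (int n - 2) * (4 + real (n choose 2)) - 1"
    using card_coord_index[of n] by (simp add: proj_dim_def dim_coord_space)
  fix W :: "(nat \<Rightarrow> 'k) set" assume W: "W \<in> Lag n"
  show "\<exists>\<Lambda>\<in>matrices n. row_space n \<Lambda> = W" using Lag_row_space[OF W] by blast
  fix \<Lambda> :: "nat \<Rightarrow> nat \<Rightarrow> 'k" assume \<Lambda>: "\<Lambda> \<in> matrices n" "row_space n \<Lambda> = W"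
  show "minors n \<Lambda> \<in> coord_space n - {0}" by (rule Lag_minors[OF W \<Lambda>])
  show "Phi n W = proj_point (minors n \<Lambda>)" by (rule Phi_eq[OF W \<Lambda>])
qed (rule Phi_inj Phi_image)+

end
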